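(* Let $M$ be a manifold endowed with a metric contact pair $(\alpha_1,\alpha_2,\phi,g)$ of type $(h,k)$ with decomposable $\phi$. Then the volume element $dV$ of the Riemannian metric $g$ is given by $$dV=\frac{(-1)^{h+k}}{2^{h+k}\,h!\,k!}\;\alpha_1\wedge(d\alpha_1)^h\wedge\alpha_2\wedge(d\alpha_2)^k .$$
   Context: All objects are smooth. Contact pair: a pair $(\alpha_1,\alpha_2)$ of $1$-forms on a manifold $M$ (of dimension $2h+2k+2$) is a contact pair of type $(h,k)$ if $\alpha_1\wedge(d\alpha_1)^h\wedge\alpha_2\wedge(d\alpha_2)^k$ is a volume form, $(d\alpha_1)^{h+1}=0$ and $(d\alpha_2)^{k+1}=0$. Characteristic foliations: for $i=1,2$ the distribution $T\mathcal F_i=\ker\alpha_i\cap\ker d\alpha_i$ (where $\ker d\alpha_i=\{X: i_Xd\alpha_i=0\}$) is completely integrable and determines the characteristic foliation $\mathcal F_i$ of $\alpha_i$. One has $TM=T\mathcal F_1\oplus T\mathcal F_2$, with $\dim\mathcal F_1=2k+1$ and $\dim\mathcal F_2=2h+1$. Reeb vector fields: $Z_1,Z_2$ are the unique vector fields with $\alpha_1(Z_1)=\alpha_2(Z_2)=1$, $\alpha_1(Z_2)=\alpha_2(Z_1)=0$, and $i_{Z_i}d\alpha_j=0$ for all $i,j\in\{1,2\}$. Contact pair structure: a triple $(\alpha_1,\alpha_2,\phi)$ where $(\alpha_1,\alpha_2)$ is a contact pair and $\phi$ is a $(1,1)$-tensor field with $\phi^2=-\mathrm{Id}+\alpha_1\otimes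 Z_1+\alpha_2\otimes Z_2$ and $\phi(Z_1)=\phi(Z_2)=0$. Metric contact pair (MCP): a quadruple $(\alpha_1,\alpha_2,\phi,g)$ where $(\alpha_1,\alpha_2,\phi)$ is a contact pair structure and $g$ is an associated metric, i.e. a Riemannian metric with $g(X,\phi Y)=(d\alpha_1+d\alpha_2)(X,Y)$ and $g(X,Z_i)=\alpha_i(X)$, $i=1,2$, for all vector fields $X,Y$. Decomposable: $\phi$ is decomposable if $\phi(T\mathcal F_i)\subset T\mathcal F_i$ for $i=1,2$. Conventions: for a $1$-form $\alpha$, $d\alpha(X,Y)=\tfrac12\big(X\alpha(Y)-Y\alpha(X)-\alpha([X,Y])\big)$, and correspondingly $(\alpha\wedge\beta)(X,Y)=\tfrac12\big(\alpha(X)\beta(Y)-\alpha(Y)\beta(X)\big)$ for $1$-forms; thus the factor $\tfrac12$ occurs only when $2$-forms are evaluated on vectors (in the determinant normalization of evaluation and the usual $d$, the associated condition reads $g(X,\phi Y)=\tfrac12(d\alpha_1+d\alpha_2)(X,Y)$). The volume element of $g$ is $\theta^1\wedge\cdots\wedge\theta^{n}$, $n=2h+2k+2$, where $(\theta^i)$ is the dual coframe of any positively oriented local $g$-orthonormal frame. The manifold $M$ is oriented by declaring positive the local orthonormal frames (called $\phi$-bases) $\{Z_1,X_1,\phi X_1,\dots,X_h,\phi X_h,Z_2,Y_1,\phi Y_1,\dots,Y_k,\phi Y_k\}$, where the vector fields $Z_1,X_j,\phi X_j$ are tangent to $\mathcal F_2$ and $Z_2,Y_j,\phi Y_j$ are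 tangent to $\mathcal F_1$. *)

theory Defs
  imports "HOL-Analysis.Analysis" "Jordan_Normal_Form.Determinant"
begin

section \<open>Smooth manifolds, given by an atlas\<close>

text \<open>Since the model space is finite dimensional, continuity of all directional derivatives
  \<open>\<lambda>x. f' x v\<close> is the same as continuity of \<open>f'\<close> in the operator norm.\<close>

primrec Ck_on :: "nat \<Rightarrow> 'e::euclidean_space set \<Rightarrow> ('e \<Rightarrow> 'b::real_normed_vector) \<Rightarrow> bool" where
  "Ck_on 0 S f \<longleftrightarrow> continuous_on S f"
| "Ck_on (Suc m) S f \<longleftrightarrow>
     (\<exists>f'. (\<forall>x\<in>S. (f has_derivative f' x) (at x)) \<and> (\<forall>v. Ck_on m S (\<lambda>x. f' x v)))"

definition smooth_on :: "'e::euclidean_space set \<Rightarrow> ('e \<Rightarrow> 'b::real_normed_vector) \<Rightarrow> bool" where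
  "smooth_on S f \<longleftrightarrow> (\<forall>m. Ck_on m S f)"

type_synonym ('a, 'e) chart = "'a set \<times> ('a \<Rightarrow> 'e)"

abbreviation chart_inv :: "('a, 'e) chart \<Rightarrow> 'e \<Rightarrow> 'a" where
  "chart_inv c \<equiv> inv_into (fst c) (snd c)"

definition smooth_manifold :: "'a topology \<Rightarrow> ('a, 'e::euclidean_space) chart set \<Rightarrow> bool" where
  "smooth_manifold M A \<longleftrightarrow>
     Hausdorff_space M \<and> second_countable M \<and>
     (\<Union>c\<in>A. fst c) = topspace M \<and>
     (\<forall>c\<in>A. openin M (fst c) \<and> open (snd c ` fst c) \<and>
        homeomorphic_map (subtopology M (fst c)) (top_of_set (snd c ` fst c)) (snd c)) \<and>
     (\<forall>c\<in>A. \<forall>d\<in>A. smooth_on (snd c ` (fst c \<inter> fst d)) (snd d \<circ> chart_inv c))"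

section \<open>Tangent vectors and tensor fields\<close>

text \<open>For every point \<open>p\<close> we fix a preferred chart around \<open>p\<close> and identify the tangent space
  at \<open>p\<close> with the model space \<open>'e\<close> by means of it: \<open>u :: 'e\<close> stands for the tangent vector at
  \<open>p\<close> with coordinates \<open>u\<close> in the preferred chart.  Its coordinates in another chart \<open>c\<close> around
  \<open>p\<close> are given by \<open>tcoord A c p\<close>, whose inverse is \<open>tvec A c p\<close>.  As the preferred chart depends
  on the point in an arbitrary way, smoothness of a tensor field always refers to its components
  in the charts of the atlas.\<close>

definition chart_at :: "('a, 'e) chart set \<Rightarrow> 'a \<Rightarrow> ('a, 'e) chart" where
  "chart_at A p = (SOME c. c \<in> A \<and> p \<in> fst c)"

definition tcoord :: "('a, 'e::euclidean_space) chart set \<Rightarrow> ('a, 'e) chart \<Rightarrow> 'a \<Rightarrow> 'e \<Rightarrow> 'e" where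
  "tcoord A c p =
     frechet_derivative (snd c \<circ> chart_inv (chart_at A p)) (at (snd (chart_at A p) p))"

definition tvec :: "('a, 'e::euclidean_space) chart set \<Rightarrow> ('a, 'e) chart \<Rightarrow> 'a \<Rightarrow> 'e \<Rightarrow> 'e" where
  "tvec A c p = frechet_derivative (snd (chart_at A p) \<circ> chart_inv c) (at (snd c p))"

definition field_coord ::
    "('a, 'e::euclidean_space) chart set \<Rightarrow> ('a, 'e) chart \<Rightarrow> ('a \<Rightarrow> 'e) \<Rightarrow> 'e \<Rightarrow> 'e" where
  "field_coord A c X y = tcoord A c (chart_inv c y) (X (chart_inv c y))"

definition vector_field :: "('a, 'e::euclidean_space) chart set \<Rightarrow> 'a set \<Rightarrow> ('a \<Rightarrow> 'e) \<Rightarrow> bool" where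
  "vector_field A W X \<longleftrightarrow> (\<forall>c\<in>A. smooth_on (snd c ` (fst c \<inter> W)) (field_coord A c X))"

definition one_form ::
    "'a topology \<Rightarrow> ('a, 'e::euclidean_space) chart set \<Rightarrow> ('a \<Rightarrow> 'e \<Rightarrow> real) \<Rightarrow> bool" where
  "one_form M A \<alpha> \<longleftrightarrow>
     (\<forall>p\<in>topspace M. linear (\<alpha> p)) \<and>
     (\<forall>c\<in>A. \<forall>u. smooth_on (snd c ` fst c)
        (\<lambda>y. \<alpha> (chart_inv c y) (tvec A c (chart_inv c y) u)))"

definition endo_field ::
    "'a topology \<Rightarrow> ('a, 'e::euclidean_space) chart set \<Rightarrow> ('a \<Rightarrow> 'e \<Rightarrow> 'e) \<Rightarrow> bool" where
  "endo_field M A \<phi> \<longleftrightarrow>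
     (\<forall>p\<in>topspace M. linear (\<phi> p)) \<and>
     (\<forall>c\<in>A. \<forall>u. smooth_on (snd c ` fst c)
        (\<lambda>y. tcoord A c (chart_inv c y) (\<phi> (chart_inv c y) (tvec A c (chart_inv c y) u))))"

definition riemannian_metric ::
    "'a topology \<Rightarrow> ('a, 'e::euclidean_space) chart set \<Rightarrow> ('a \<Rightarrow> 'e \<Rightarrow> 'e \<Rightarrow> real) \<Rightarrow> bool" where
  "riemannian_metric M A g \<longleftrightarrow>
     (\<forall>p\<in>topspace M. bilinear (g p) \<and> (\<forall>u v. g p u v = g p v u) \<and> (\<forall>u. u \<noteq> 0 \<longrightarrow> g p u u > 0)) \<and>
     (\<forall>c\<in>A. \<forall>u v. smooth_on (snd c ` fst c)
        (\<lambda>y. g (chart_inv c y) (tvec A c (chart_inv c y) u) (tvec A c (chart_inv c y) v)))"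

section \<open>Exterior derivative of a 1-form\<close>

text \<open>\<open>X f\<close> and \<open>[X, Y]\<close> are computed in the preferred chart at \<open>p\<close>, in which the coordinates of
  \<open>X p\<close> are \<open>X p\<close> itself; by the chain rule and the symmetry of second derivatives every other
  chart around \<open>p\<close> gives the same result.\<close>

definition lie_deriv ::
    "('a, 'e::euclidean_space) chart set \<Rightarrow> ('a \<Rightarrow> 'e) \<Rightarrow> ('a \<Rightarrow> real) \<Rightarrow> 'a \<Rightarrow> real" where
  "lie_deriv A X f p =
     frechet_derivative (f \<circ> chart_inv (chart_at A p)) (at (snd (chart_at A p) p)) (X p)"

definition lie_bracket ::
    "('a, 'e::euclidean_space) chart set \<Rightarrow> ('a \<Rightarrow> 'e) \<Rightarrow> ('a \<Rightarrow> 'e) \<Rightarrow> 'a \<Rightarrow> 'e" where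
  "lie_bracket A X Y p = (let c = chart_at A p in
     frechet_derivative (field_coord A c Y) (at (snd c p)) (X p) -
     frechet_derivative (field_coord A c X) (at (snd c p)) (Y p))"

definition ext_d_fields ::
    "('a, 'e::euclidean_space) chart set \<Rightarrow> ('a \<Rightarrow> 'e \<Rightarrow> real) \<Rightarrow> ('a \<Rightarrow> 'e) \<Rightarrow> ('a \<Rightarrow> 'e) \<Rightarrow> 'a \<Rightarrow> real" where
  "ext_d_fields A \<alpha> X Y p =
     (lie_deriv A X (\<lambda>q. \<alpha> q (Y q)) p - lie_deriv A Y (\<lambda>q. \<alpha> q (X q)) p
      - \<alpha> p (lie_bracket A X Y p)) / 2"

text \<open>The value of \<open>d\<alpha>\<close> on two tangent vectors at \<open>p\<close> is obtained by extending them to the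
  coordinate fields with constant coefficients in the preferred chart at \<open>p\<close>.  Any other
  extension gives the same value, see \<open>ext_d_eq_fields\<close> below.\<close>

definition ext_d ::
    "('a, 'e::euclidean_space) chart set \<Rightarrow> ('a \<Rightarrow> 'e \<Rightarrow> real) \<Rightarrow> 'a \<Rightarrow> 'e \<Rightarrow> 'e \<Rightarrow> real" where
  "ext_d A \<alpha> p u v = (let c = chart_at A p in
     ext_d_fields A \<alpha> (\<lambda>q. tvec A c q u) (\<lambda>q. tvec A c q v) p)"

section \<open>Exterior algebra of a tangent space\<close>

text \<open>A form of degree \<open>m\<close> is a function of a sequence of vectors, of which it uses the first
  \<open>m\<close> entries.  The wedge product is normalised as the alternation of the tensor product,
  so that it has the factor \<open>1/2\<close> on a pair of 1-forms, in accordance with \<open>ext_d\<close>.\<close>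

type_synonym 'e form = "(nat \<Rightarrow> 'e) \<Rightarrow> real"

definition form1 :: "('e \<Rightarrow> real) \<Rightarrow> 'e form" where
  "form1 a v = a (v 0)"

definition form2 :: "('e \<Rightarrow> 'e \<Rightarrow> real) \<Rightarrow> 'e form" where
  "form2 b v = b (v 0) (v 1)"

definition wedge :: "nat \<Rightarrow> nat \<Rightarrow> 'e form \<Rightarrow> 'e form \<Rightarrow> 'e form" where
  "wedge r s \<omega> \<eta> v =
     (\<Sum>\<sigma> | \<sigma> permutes {..<r + s}.
        of_int (sign \<sigma>) * \<omega> (\<lambda>i. v (\<sigma> i)) * \<eta> (\<lambda>i. v (\<sigma> (r + i)))) / fact (r + s)"

primrec wedge_power2 :: "'e form \<Rightarrow> nat \<Rightarrow> 'e form" where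
  "wedge_power2 \<omega> 0 = (\<lambda>v. 1)"
| "wedge_power2 \<omega> (Suc m) = wedge 2 (2 * m) \<omega> (wedge_power2 \<omega> m)"

primrec wedge_coframe :: "(nat \<Rightarrow> 'e \<Rightarrow> real) \<Rightarrow> nat \<Rightarrow> 'e form" where
  "wedge_coframe \<theta> 0 = (\<lambda>v. 1)"
| "wedge_coframe \<theta> (Suc m) = wedge m 1 (wedge_coframe \<theta> m) (form1 (\<theta> m))"

section \<open>Metric contact pairs\<close>

definition contact_pair_form ::
    "('a, 'e::euclidean_space) chart set \<Rightarrow> nat \<Rightarrow> nat \<Rightarrow> ('a \<Rightarrow> 'e \<Rightarrow> real) \<Rightarrow> ('a \<Rightarrow> 'e \<Rightarrow> real)
      \<Rightarrow> 'a \<Rightarrow> 'e form" where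
  "contact_pair_form A h k \<alpha>\<^sub>1 \<alpha>\<^sub>2 p =
     wedge (2 * h + 1) (2 * k + 1)
       (wedge 1 (2 * h) (form1 (\<alpha>\<^sub>1 p)) (wedge_power2 (form2 (ext_d A \<alpha>\<^sub>1 p)) h))
       (wedge 1 (2 * k) (form1 (\<alpha>\<^sub>2 p)) (wedge_power2 (form2 (ext_d A \<alpha>\<^sub>2 p)) k))"

definition contact_pair ::
    "'a topology \<Rightarrow> ('a, 'e::euclidean_space) chart set \<Rightarrow> nat \<Rightarrow> nat
      \<Rightarrow> ('a \<Rightarrow> 'e \<Rightarrow> real) \<Rightarrow> ('a \<Rightarrow> 'e \<Rightarrow> real) \<Rightarrow> bool" where
  "contact_pair M A h k \<alpha>\<^sub>1 \<alpha>\<^sub>2 \<longleftrightarrow>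
     DIM('e) = 2 * h + 2 * k + 2 \<and> one_form M A \<alpha>\<^sub>1 \<and> one_form M A \<alpha>\<^sub>2 \<and>
     (\<forall>p\<in>topspace M.
        contact_pair_form A h k \<alpha>\<^sub>1 \<alpha>\<^sub>2 p \<noteq> (\<lambda>v. 0) \<and>
        wedge_power2 (form2 (ext_d A \<alpha>\<^sub>1 p)) (h + 1) = (\<lambda>v. 0) \<and>
        wedge_power2 (form2 (ext_d A \<alpha>\<^sub>2 p)) (k + 1) = (\<lambda>v. 0))"

definition char_distribution ::
    "('a, 'e::euclidean_space) chart set \<Rightarrow> ('a \<Rightarrow> 'e \<Rightarrow> real) \<Rightarrow> 'a \<Rightarrow> 'e set" where
  "char_distribution A \<alpha> p = {u. \<alpha> p u = 0} \<inter> {u. \<forall>v. ext_d A \<alpha> p u v = 0}"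

definition reeb_fields ::
    "'a topology \<Rightarrow> ('a, 'e::euclidean_space) chart set
      \<Rightarrow> ('a \<Rightarrow> 'e \<Rightarrow> real) \<Rightarrow> ('a \<Rightarrow> 'e \<Rightarrow> real) \<Rightarrow> ('a \<Rightarrow> 'e) \<Rightarrow> ('a \<Rightarrow> 'e) \<Rightarrow> bool" where
  "reeb_fields M A \<alpha>\<^sub>1 \<alpha>\<^sub>2 Z\<^sub>1 Z\<^sub>2 \<longleftrightarrow>
     vector_field A (topspace M) Z\<^sub>1 \<and> vector_field A (topspace M) Z\<^sub>2 \<and>
     (\<forall>p\<in>topspace M.
        \<alpha>\<^sub>1 p (Z\<^sub>1 p) = 1 \<and> \<alpha>\<^sub>2 p (Z\<^sub>2 p) = 1 \<and> \<alpha>\<^sub>1 p (Z\<^sub>2 p) = 0 \<and> \<alpha>\<^sub>2 p (Z\<^sub>1 p) = 0 \<and>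
        (\<forall>v. ext_d A \<alpha>\<^sub>1 p (Z\<^sub>1 p) v = 0 \<and> ext_d A \<alpha>\<^sub>2 p (Z\<^sub>1 p) v = 0 \<and>
             ext_d A \<alpha>\<^sub>1 p (Z\<^sub>2 p) v = 0 \<and> ext_d A \<alpha>\<^sub>2 p (Z\<^sub>2 p) v = 0))"

definition contact_pair_structure ::
    "'a topology \<Rightarrow> ('a, 'e::euclidean_space) chart set \<Rightarrow> nat \<Rightarrow> nat
      \<Rightarrow> ('a \<Rightarrow> 'e \<Rightarrow> real) \<Rightarrow> ('a \<Rightarrow> 'e \<Rightarrow> real) \<Rightarrow> ('a \<Rightarrow> 'e) \<Rightarrow> ('a \<Rightarrow> 'e)
      \<Rightarrow> ('a \<Rightarrow> 'e \<Rightarrow> 'e) \<Rightarrow> bool" where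
  "contact_pair_structure M A h k \<alpha>\<^sub>1 \<alpha>\<^sub>2 Z\<^sub>1 Z\<^sub>2 \<phi> \<longleftrightarrow>
     contact_pair M A h k \<alpha>\<^sub>1 \<alpha>\<^sub>2 \<and> reeb_fields M A \<alpha>\<^sub>1 \<alpha>\<^sub>2 Z\<^sub>1 Z\<^sub>2 \<and> endo_field M A \<phi> \<and>
     (\<forall>p\<in>topspace M.
        (\<forall>u. \<phi> p (\<phi> p u) = - u + \<alpha>\<^sub>1 p u *\<^sub>R Z\<^sub>1 p + \<alpha>\<^sub>2 p u *\<^sub>R Z\<^sub>2 p) \<and>
        \<phi> p (Z\<^sub>1 p) = 0 \<and> \<phi> p (Z\<^sub>2 p) = 0)"

definition metric_contact_pair ::
    "'a topology \<Rightarrow> ('a, 'e::euclidean_space) chart set \<Rightarrow> nat \<Rightarrow> nat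
      \<Rightarrow> ('a \<Rightarrow> 'e \<Rightarrow> real) \<Rightarrow> ('a \<Rightarrow> 'e \<Rightarrow> real) \<Rightarrow> ('a \<Rightarrow> 'e) \<Rightarrow> ('a \<Rightarrow> 'e)
      \<Rightarrow> ('a \<Rightarrow> 'e \<Rightarrow> 'e) \<Rightarrow> ('a \<Rightarrow> 'e \<Rightarrow> 'e \<Rightarrow> real) \<Rightarrow> bool" where
  "metric_contact_pair M A h k \<alpha>\<^sub>1 \<alpha>\<^sub>2 Z\<^sub>1 Z\<^sub>2 \<phi> g \<longleftrightarrow>
     contact_pair_structure M A h k \<alpha>\<^sub>1 \<alpha>\<^sub>2 Z\<^sub>1 Z\<^sub>2 \<phi> \<and> riemannian_metric M A g \<and>
     (\<forall>p\<in>topspace M. \<forall>u.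
        (\<forall>v. g p u (\<phi> p v) = ext_d A \<alpha>\<^sub>1 p u v + ext_d A \<alpha>\<^sub>2 p u v) \<and>
        g p u (Z\<^sub>1 p) = \<alpha>\<^sub>1 p u \<and> g p u (Z\<^sub>2 p) = \<alpha>\<^sub>2 p u)"

definition decomposable ::
    "'a topology \<Rightarrow> ('a, 'e::euclidean_space) chart set
      \<Rightarrow> ('a \<Rightarrow> 'e \<Rightarrow> real) \<Rightarrow> ('a \<Rightarrow> 'e \<Rightarrow> real) \<Rightarrow> ('a \<Rightarrow> 'e \<Rightarrow> 'e) \<Rightarrow> bool" where
  "decomposable M A \<alpha>\<^sub>1 \<alpha>\<^sub>2 \<phi> \<longleftrightarrow>
     (\<forall>p\<in>topspace M. \<phi> p ` char_distribution A \<alpha>\<^sub>1 p \<subseteq> char_distribution A \<alpha>\<^sub>1 p \<and>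
                     \<phi> p ` char_distribution A \<alpha>\<^sub>2 p \<subseteq> char_distribution A \<alpha>\<^sub>2 p)"

section \<open>Orientation and volume element\<close>

text \<open>The value at \<open>p\<close> of the wedge product of a local coframe, and the sign of a local frame,
  depend only on the values of the frame at \<open>p\<close>.  Frames are therefore taken in each tangent
  space separately.\<close>

definition orthonormal_frame :: "('e::euclidean_space \<Rightarrow> 'e \<Rightarrow> real) \<Rightarrow> 'e list \<Rightarrow> bool" where
  "orthonormal_frame b E \<longleftrightarrow> length E = DIM('e) \<and>
     (\<forall>i<length E. \<forall>j<length E. b (E ! i) (E ! j) = (if i = j then 1 else 0))"

definition phi_basis ::
    "('a, 'e::euclidean_space) chart set \<Rightarrow> nat \<Rightarrow> nat
      \<Rightarrow> ('a \<Rightarrow> 'e \<Rightarrow> real) \<Rightarrow> ('a \<Rightarrow> 'e \<Rightarrow> real) \<Rightarrow> ('a \<Rightarrow> 'e) \<Rightarrow> ('a \<Rightarrow> 'e)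
      \<Rightarrow> ('a \<Rightarrow> 'e \<Rightarrow> 'e) \<Rightarrow> ('a \<Rightarrow> 'e \<Rightarrow> 'e \<Rightarrow> real) \<Rightarrow> 'a \<Rightarrow> 'e list \<Rightarrow> bool" where
  "phi_basis A h k \<alpha>\<^sub>1 \<alpha>\<^sub>2 Z\<^sub>1 Z\<^sub>2 \<phi> g p E \<longleftrightarrow>
     orthonormal_frame (g p) E \<and>
     (\<exists>Xs Ys. length Xs = h \<and> length Ys = k \<and>
        E = Z\<^sub>1 p # concat (map (\<lambda>X. [X, \<phi> p X]) Xs) @ Z\<^sub>2 p # concat (map (\<lambda>Y. [Y, \<phi> p Y]) Ys) \<and>
        {Z\<^sub>1 p} \<union> set Xs \<union> \<phi> p ` set Xs \<subseteq> char_distribution A \<alpha>\<^sub>2 p \<and>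
        {Z\<^sub>2 p} \<union> set Ys \<union> \<phi> p ` set Ys \<subseteq> char_distribution A \<alpha>\<^sub>1 p)"

definition same_orientation :: "'e::euclidean_space list \<Rightarrow> 'e list \<Rightarrow> bool" where
  "same_orientation E F \<longleftrightarrow> length E = length F \<and>
     (\<exists>B \<in> carrier_mat (length E) (length E).
        (\<forall>j<length E. F ! j = (\<Sum>i<length E. B $$ (i, j) *\<^sub>R E ! i)) \<and> Determinant.det B > 0)"

definition phi_orientation ::
    "('a, 'e::euclidean_space) chart set \<Rightarrow> nat \<Rightarrow> nat
      \<Rightarrow> ('a \<Rightarrow> 'e \<Rightarrow> real) \<Rightarrow> ('a \<Rightarrow> 'e \<Rightarrow> real) \<Rightarrow> ('a \<Rightarrow> 'e) \<Rightarrow> ('a \<Rightarrow> 'e)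
      \<Rightarrow> ('a \<Rightarrow> 'e \<Rightarrow> 'e) \<Rightarrow> ('a \<Rightarrow> 'e \<Rightarrow> 'e \<Rightarrow> real) \<Rightarrow> 'a \<Rightarrow> 'e list set" where
  "phi_orientation A h k \<alpha>\<^sub>1 \<alpha>\<^sub>2 Z\<^sub>1 Z\<^sub>2 \<phi> g p =
     {F. \<exists>E. phi_basis A h k \<alpha>\<^sub>1 \<alpha>\<^sub>2 Z\<^sub>1 Z\<^sub>2 \<phi> g p E \<and> same_orientation E F}"

definition dual_coframe :: "'e::euclidean_space list \<Rightarrow> (nat \<Rightarrow> 'e \<Rightarrow> real) \<Rightarrow> bool" where
  "dual_coframe E \<theta> \<longleftrightarrow>
     (\<forall>i<length E. linear (\<theta> i) \<and> (\<forall>j<length E. \<theta> i (E ! j) = (if i = j then 1 else 0)))"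

text \<open>Here \<open>orient p\<close> is the set of positive bases of the tangent space at \<open>p\<close>.\<close>

definition volume_element ::
    "('a \<Rightarrow> 'e::euclidean_space list set) \<Rightarrow> ('a \<Rightarrow> 'e \<Rightarrow> 'e \<Rightarrow> real) \<Rightarrow> 'a \<Rightarrow> 'e form" where
  "volume_element orient g p =
     (THE \<omega>. \<forall>E \<theta>. orthonormal_frame (g p) E \<and> E \<in> orient p \<and> dual_coframe E \<theta> \<longrightarrow>
        \<omega> = wedge_coframe \<theta> DIM('e))"

section \<open>The exterior derivative on arbitrary vector fields\<close>

lemma smooth_on_differentiable:
  assumes "smooth_on S f" "x \<in> S"
  shows "f differentiable (at x)"
proof -
  have "Ck_on (Suc 0) S f"
    using assms(1) by (simp only: smooth_on_def)
  then show ?thesis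
    using assms(2) by (auto simp: differentiable_def)
qed

context
  fixes M :: "'a topology" and A :: "('a, 'e::euclidean_space) chart set"
  assumes mfd: "smooth_manifold M A"
begin

lemma chart_at:
  assumes "p \<in> topspace M"
  shows "chart_at A p \<in> A" "p \<in> fst (chart_at A p)"
proof -
  have "\<exists>c. c \<in> A \<and> p \<in> fst c"
    using assms mfd unfolding smooth_manifold_def by blast
  then have "chart_at A p \<in> A \<and> p \<in> fst (chart_at A p)"
    unfolding chart_at_def by (rule someI_ex)
  then show "chart_at A p \<in> A" "p \<in> fst (chart_at A p)" by auto
qed

lemma chart_inj: "c \<in> A \<Longrightarrow> inj_on (snd c) (fst c)"
  using mfd unfolding smooth_manifold_def homeomorphic_map_def quotient_map_def
  by (auto simp: homeomorphic_map_def)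
     (metis (no_types, lifting) fst_conv inf.absorb_iff2 openin_subset snd_conv topspace_subtopology)

lemma chart_sub: "c \<in> A \<Longrightarrow> fst c \<subseteq> topspace M"
  using mfd unfolding smooth_manifold_def by blast

lemma open_chart_image:
  assumes "c \<in> A" "openin M W"
  shows "open (snd c ` (fst c \<inter> W))"
proof -
  have h: "homeomorphic_map (subtopology M (fst c)) (top_of_set (snd c ` fst c)) (snd c)"
    and o: "open (snd c ` fst c)"
    using assms(1) mfd unfolding smooth_manifold_def by auto
  have "openin (subtopology M (fst c)) (fst c \<inter> W)"
    using assms(2) by (auto simp: openin_subtopology)
  then have "openin (top_of_set (snd c ` fst c)) (snd c ` (fst c \<inter> W))"
    using homeomorphic_imp_open_map[OF h] unfolding open_map_def by blast
  then show ?thesis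
    using o openin_open_trans by blast
qed

lemma transition_differentiable:
  assumes "c \<in> A" "d \<in> A" "q \<in> fst c" "q \<in> fst d"
  shows "(snd d \<circ> chart_inv c) differentiable (at (snd c q))"
proof (rule smooth_on_differentiable)
  show "smooth_on (snd c ` (fst c \<inter> fst d)) (snd d \<circ> chart_inv c)"
    using assms mfd unfolding smooth_manifold_def by blast
qed (use assms in auto)

lemma frechet_transition_inverse:
  assumes "c \<in> A" "d \<in> A" "q \<in> fst c" "q \<in> fst d"
  shows "frechet_derivative (snd c \<circ> chart_inv d) (at (snd d q))
           (frechet_derivative (snd d \<circ> chart_inv c) (at (snd c q)) u) = u"
proof -
  let ?f = "snd d \<circ> chart_inv c" and ?g = "snd c \<circ> chart_inv d"
  let ?S = "snd c ` (fst c \<inter> fst d)"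
  have fq: "?f (snd c q) = snd d q"
    using assms chart_inj by (simp add: inv_into_f_f)
  have "(?f has_derivative frechet_derivative ?f (at (snd c q))) (at (snd c q))"
    using transition_differentiable[OF assms] by (simp add: frechet_derivative_works)
  moreover have "(?g has_derivative frechet_derivative ?g (at (snd d q))) (at (?f (snd c q)))"
    using transition_differentiable[OF assms(2,1,4,3)] unfolding fq
    by (simp add: frechet_derivative_works)
  ultimately have 1: "(?g \<circ> ?f has_derivative
      frechet_derivative ?g (at (snd d q)) \<circ> frechet_derivative ?f (at (snd c q))) (at (snd c q))"
    by (rule diff_chain_at)
  have "open ?S"
    using open_chart_image[OF assms(1)] assms(2) mfd unfolding smooth_manifold_def by blast
  then have 2: "(?g \<circ> ?f has_derivative (\<lambda>u. u)) (at (snd c q))"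
  proof (rule has_derivative_transform_within_open[OF has_derivative_ident])
    show "snd c q \<in> ?S" using assms by auto
    show "y = (?g \<circ> ?f) y" if "y \<in> ?S" for y
      using that assms chart_inj by (auto simp: inv_into_f_f)
  qed
  show ?thesis
    using has_derivative_unique[OF 1 2] by (metis comp_apply)
qed

lemma tvec_tcoord:
  assumes "c \<in> A" "q \<in> fst c"
  shows "tvec A c q (tcoord A c q u) = u" "tcoord A c q (tvec A c q u) = u"
proof -
  have "q \<in> topspace M" using assms chart_sub by blast
  note c = chart_at[OF this]
  show "tvec A c q (tcoord A c q u) = u"
    unfolding tvec_def tcoord_def using frechet_transition_inverse[OF c(1) assms(1) c(2) assms(2)] .
  show "tcoord A c q (tvec A c q u) = u"
    unfolding tvec_def tcoord_def using frechet_transition_inverse[OF assms(1) c(1) assms(2) c(2)] .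
qed

lemma linear_tvec:
  assumes "c \<in> A" "q \<in> fst c"
  shows "linear (tvec A c q)"
proof -
  have "q \<in> topspace M" using assms chart_sub by blast
  note c = chart_at[OF this]
  show ?thesis
    unfolding tvec_def
    by (rule linear_frechet_derivative[OF transition_differentiable[OF assms(1) c(1) assms(2) c(2)]])
qed

lemma tvec_chart_at:
  assumes "p \<in> topspace M"
  shows "tvec A (chart_at A p) p = (\<lambda>u. u)" "tcoord A (chart_at A p) p = (\<lambda>u. u)"
proof -
  let ?c = "chart_at A p"
  note c = chart_at[OF assms]
  have o: "open (snd ?c ` fst ?c)"
    using c mfd unfolding smooth_manifold_def by blast
  have "((snd ?c \<circ> chart_inv ?c) has_derivative (\<lambda>u. u)) (at (snd ?c p))"
    by (rule has_derivative_transform_within_open[OF has_derivative_ident o])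
       (use c in \<open>auto simp: f_inv_into_f\<close>)
  then have "frechet_derivative (snd ?c \<circ> chart_inv ?c) (at (snd ?c p)) = (\<lambda>u. u)"
    using frechet_derivative_at by metis
  then show "tvec A ?c p = (\<lambda>u. u)" "tcoord A ?c p = (\<lambda>u. u)"
    unfolding tvec_def tcoord_def by auto
qed

text \<open>\<open>D e w\<close> is the derivative at \<open>p\<close>, in the direction \<open>w\<close>, of the component of \<open>\<alpha>\<close> along the
  coordinate field \<open>e\<close>.\<close>

lemma lie_deriv_one_form:
  assumes \<alpha>: "one_form M A \<alpha>" and p: "p \<in> topspace M"
  defines "c \<equiv> chart_at A p"
  defines "D \<equiv> \<lambda>e. frechet_derivative (\<lambda>y. \<alpha> (chart_inv c y) (tvec A c (chart_inv c y) e)) (at (snd c p))"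
  assumes W: "openin M W" "p \<in> W" and Y: "field_coord A c Y differentiable (at (snd c p))"
  shows "lie_deriv A X (\<lambda>q. \<alpha> q (Y q)) p =
    \<alpha> p (frechet_derivative (field_coord A c Y) (at (snd c p)) (X p)) +
    (\<Sum>b\<in>Basis. (Y p \<bullet> b) * D b (X p))"
proof -
  note c = chart_at[OF p, folded c_def]
  let ?V = "snd c ` (fst c \<inter> W)" and ?y = "snd c p"
  let ?a = "\<lambda>e y. \<alpha> (chart_inv c y) (tvec A c (chart_inv c y) e)"
  let ?Y = "field_coord A c Y" and ?DY = "frechet_derivative (field_coord A c Y) (at (snd c p))"
  have V: "open ?V" "?y \<in> ?V" using open_chart_image[OF c(1) W(1)] c W by auto
  have inv: "chart_inv c ?y = p" using c chart_inj by (simp add: inv_into_f_f)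
  have Yp: "?Y ?y = Y p"
    unfolding field_coord_def inv using tvec_chart_at[OF p] by (simp add: c_def)
  have a_p: "?a e ?y = \<alpha> p e" for e
    unfolding inv using tvec_chart_at[OF p] by (simp add: c_def)
  have lin: "linear (\<alpha> q)" if "q \<in> fst c" for q
    using \<alpha> chart_sub[OF c(1)] that unfolding one_form_def by blast
  have expand: "\<alpha> (chart_inv c y) (Y (chart_inv c y)) = (\<Sum>b\<in>Basis. (?Y y \<bullet> b) * ?a b y)"
    if "y \<in> ?V" for y
  proof -
    have q: "chart_inv c y \<in> fst c" using that by (auto intro: inv_into_into)
    have "?a (\<Sum>b\<in>Basis. (?Y y \<bullet> b) *\<^sub>R b) y = (\<Sum>b\<in>Basis. (?Y y \<bullet> b) * ?a b y)"
      using linear_tvec[OF c(1) q] lin[OF q] by (simp add: linear_sum linear_cmul)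
    moreover have "?a (?Y y) y = \<alpha> (chart_inv c y) (Y (chart_inv c y))"
      unfolding field_coord_def using tvec_tcoord(1)[OF c(1) q] by simp
    ultimately show ?thesis by (simp add: euclidean_representation)
  qed
  have DYd: "(?Y has_derivative ?DY) (at ?y)"
    using Y by (simp add: frechet_derivative_works)
  have Da: "(?a e has_derivative D e) (at ?y)" for e
  proof -
    have "?a e differentiable (at ?y)"
      by (rule smooth_on_differentiable[of "snd c ` fst c"])
         (use \<alpha> c in \<open>auto simp: one_form_def\<close>)
    then show ?thesis unfolding D_def by (simp add: frechet_derivative_works)
  qed
  have "((\<lambda>y. \<Sum>b\<in>Basis. (?Y y \<bullet> b) * ?a b y) has_derivative
     (\<lambda>w. \<Sum>b\<in>Basis. (?Y ?y \<bullet> b) * D b w + (?DY w \<bullet> b) * ?a b ?y)) (at ?y)"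
    by (intro has_derivative_sum has_derivative_mult Da has_derivative_inner_left DYd)
  then have "((\<lambda>y. \<alpha> (chart_inv c y) (Y (chart_inv c y))) has_derivative
     (\<lambda>w. \<Sum>b\<in>Basis. (?Y ?y \<bullet> b) * D b w + (?DY w \<bullet> b) * ?a b ?y)) (at ?y)"
    by (rule has_derivative_transform_within_open[OF _ V]) (simp add: expand)
  then have "frechet_derivative ((\<lambda>q. \<alpha> q (Y q)) \<circ> chart_inv c) (at ?y) =
     (\<lambda>w. \<Sum>b\<in>Basis. (?Y ?y \<bullet> b) * D b w + (?DY w \<bullet> b) * ?a b ?y)"
    unfolding o_def by (rule frechet_derivative_at[symmetric])
  then have "lie_deriv A X (\<lambda>q. \<alpha> q (Y q)) p =
      (\<Sum>b\<in>Basis. (Y p \<bullet> b) * D b (X p)) + (\<Sum>b\<in>Basis. (?DY (X p) \<bullet> b) * \<alpha> p b)"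
    unfolding lie_deriv_def c_def[symmetric] by (simp add: Yp a_p sum.distrib)
  also have "(\<Sum>b\<in>Basis. (?DY (X p) \<bullet> b) * \<alpha> p b) = \<alpha> p (\<Sum>b\<in>Basis. (?DY (X p) \<bullet> b) *\<^sub>R b)"
    using lin[OF c(2)] by (simp add: linear_sum linear_cmul)
  finally show ?thesis by (simp add: euclidean_representation)
qed

lemma ext_d_fields_eq:
  assumes \<alpha>: "one_form M A \<alpha>" and p: "p \<in> topspace M"
  defines "c \<equiv> chart_at A p"
  defines "D \<equiv> \<lambda>e. frechet_derivative (\<lambda>y. \<alpha> (chart_inv c y) (tvec A c (chart_inv c y) e)) (at (snd c p))"
  assumes W: "openin M W" "p \<in> W"
    and X: "field_coord A c X differentiable (at (snd c p))"
    and Y: "field_coord A c Y differentiable (at (snd c p))"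
  shows "ext_d_fields A \<alpha> X Y p =
    ((\<Sum>b\<in>Basis. (Y p \<bullet> b) * D b (X p)) - (\<Sum>b\<in>Basis. (X p \<bullet> b) * D b (Y p))) / 2"
proof -
  have "linear (\<alpha> p)" using \<alpha> p unfolding one_form_def by blast
  then show ?thesis
    unfolding ext_d_fields_def lie_bracket_def Let_def
    using lie_deriv_one_form[OF \<alpha> p W Y[unfolded c_def], of X]
      lie_deriv_one_form[OF \<alpha> p W X[unfolded c_def], of Y]
    by (simp add: linear_diff D_def c_def)
qed

lemma field_coord_tvec:
  assumes "p \<in> topspace M"
  defines "c \<equiv> chart_at A p"
  shows "field_coord A c (\<lambda>q. tvec A c q u) differentiable (at (snd c p))"
proof -
  note c = chart_at[OF assms(1), folded c_def]
  have o: "open (snd c ` fst c)"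
    using c mfd unfolding smooth_manifold_def by blast
  have "(field_coord A c (\<lambda>q. tvec A c q u) has_derivative (\<lambda>_. 0)) (at (snd c p))"
  proof (rule has_derivative_transform_within_open[OF has_derivative_const[of u] o])
    show "snd c p \<in> snd c ` fst c" using c by auto
    show "u = field_coord A c (\<lambda>q. tvec A c q u) y" if "y \<in> snd c ` fst c" for y
      unfolding field_coord_def using tvec_tcoord(2)[OF c(1)] inv_into_into[OF that] by simp
  qed
  then show ?thesis unfolding differentiable_def by blast
qed

theorem ext_d_eq_fields:
  assumes \<alpha>: "one_form M A \<alpha>" and p: "p \<in> W" and W: "openin M W"
    and X: "vector_field A W X" and Y: "vector_field A W Y"
  shows "ext_d A \<alpha> p (X p) (Y p) = ext_d_fields A \<alpha> X Y p"
proof -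
  have pM: "p \<in> topspace M" using p openin_subset[OF W] by blast
  note c = chart_at[OF pM]
  have d: "field_coord A (chart_at A p) Z differentiable (at (snd (chart_at A p) p))"
    if "vector_field A W Z" for Z
    by (rule smooth_on_differentiable) (use that c p in \<open>auto simp: vector_field_def\<close>)
  show ?thesis
    unfolding ext_d_def Let_def ext_d_fields_eq[OF \<alpha> pM W p d[OF X] d[OF Y]]
      ext_d_fields_eq[OF \<alpha> pM W p field_coord_tvec[OF pM] field_coord_tvec[OF pM]]
    using tvec_chart_at[OF pM] by simp
qed

end

end

theory Submission
  imports Defs
begin

text \<open>A top degree form on a tangent space is determined by its value on one basis, so it suffices to
  evaluate \<open>\<alpha>\<^sub>1 \<and> (d\<alpha>\<^sub>1)\<^sup>h \<and> \<alpha>\<^sub>2 \<and> (d\<alpha>\<^sub>2)\<^sup>k\<close> on a \<open>\<phi>\<close>-basis. There \<open>d\<alpha>\<^sub>1\<close> pairs \<open>X\<^sub>j\<close>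
  with \<open>\<phi>X\<^sub>j\<close> to \<open>-1\<close> and vanishes on all other pairs of basis vectors, similarly for \<open>d\<alpha>\<^sub>2\<close>, and
  counting the permutations that respect the pairs gives \<open>(-2)\<^sup>h h! (-2)\<^sup>k k!\<close>.

  A \<open>\<phi>\<close>-basis exists because \<open>(d\<alpha>\<^sub>1)\<^sup>h\<^sup>+\<^sup>1 = 0\<close> bounds the rank of \<open>d\<alpha>\<^sub>1\<close> by \<open>2 h\<close>, so that the part
  of \<open>T\<F>\<^sub>1\<close> orthogonal to the Reeb vectors has dimension at least \<open>2 k\<close>. On it, \<open>\<phi>\<close> is an
  orthogonal complex structure because \<open>\<phi>\<close> is decomposable. The same holds for \<open>T\<F>\<^sub>2\<close>, and the
  two parts are orthogonal to each other.\<close>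

section \<open>Signed sums over permutations\<close>

text \<open>The alternation without its factor \<open>1 / fact n\<close>. All wedge products below
  are brought to the form \<open>alt_sum n f v / fact n\<close>, so the factorials cancel when two
  forms of the same degree are compared.\<close>

definition alt_sum :: "nat \<Rightarrow> 'e form \<Rightarrow> 'e form" where
  "alt_sum n f v = (\<Sum>\<sigma> | \<sigma> permutes {..<n}. of_int (sign \<sigma>) * f (\<lambda>i. v (\<sigma> i)))"

definition depends_below :: "nat \<Rightarrow> 'e form \<Rightarrow> bool" where
  "depends_below n f \<longleftrightarrow> (\<forall>v w. (\<forall>i<n. v i = w i) \<longrightarrow> f v = f w)"

lemma depends_belowD: "depends_below n f \<Longrightarrow> (\<And>i. i < n \<Longrightarrow> v i = w i) \<Longrightarrow> f v = f w"
  unfolding depends_below_def by blast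

lemma permutes_lessThan_permutation: "\<sigma> permutes {..<n::nat} \<Longrightarrow> permutation \<sigma>"
  using permutation_permutes by blast

lemma permutes_lessThan_mono: "\<sigma> permutes {..<m::nat} \<Longrightarrow> m \<le> n \<Longrightarrow> \<sigma> permutes {..<n}"
  by (erule permutes_subset) auto

text \<open>Permuting the vectors amounts to composing the summation index with
  \<open>\<tau>\<close> on the left. In \<open>alt_sum_perm_arg\<close> the slots of
  \<open>f\<close> are permuted instead, and the composition is on the right.\<close>

lemma alt_sum_permute:
  assumes \<tau>: "\<tau> permutes {..<n}"
  shows "alt_sum n f (\<lambda>i. v (\<tau> i)) = of_int (sign \<tau>) * alt_sum n f v"
proof -
  have "alt_sum n f v =
      (\<Sum>\<sigma> | \<sigma> permutes {..<n}. of_int (sign (\<tau> \<circ> \<sigma>)) * f (\<lambda>i. v ((\<tau> \<circ> \<sigma>) i)))"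
    unfolding alt_sum_def by (rule setum_permutations_compose_left[OF \<tau>])
  also have "\<dots> = of_int (sign \<tau>) * alt_sum n f (\<lambda>i. v (\<tau> i))"
    unfolding alt_sum_def sum_distrib_left
    by (intro sum.cong refl)
      (simp add: sign_compose permutes_lessThan_permutation[OF \<tau>] permutes_lessThan_permutation)
  finally show ?thesis
    by (simp flip: mult.assoc of_int_mult)
qed

lemma alt_sum_perm_arg:
  assumes \<tau>: "\<tau> permutes {..<n}"
  shows "alt_sum n (\<lambda>w. f (\<lambda>i. w (\<tau> i))) v = of_int (sign \<tau>) * alt_sum n f v"
proof -
  have "alt_sum n f v =
      (\<Sum>\<sigma> | \<sigma> permutes {..<n}. of_int (sign (\<sigma> \<circ> \<tau>)) * f (\<lambda>i. v ((\<sigma> \<circ> \<tau>) i)))"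
    unfolding alt_sum_def by (rule sum_permutations_compose_right[OF \<tau>])
  also have "\<dots> = of_int (sign \<tau>) * alt_sum n (\<lambda>w. f (\<lambda>i. w (\<tau> i))) v"
    unfolding alt_sum_def sum_distrib_left
    by (intro sum.cong refl)
      (simp add: sign_compose permutes_lessThan_permutation[OF \<tau>] permutes_lessThan_permutation)
  finally show ?thesis
    by (simp flip: mult.assoc of_int_mult)
qed

lemma alt_sum_sum: "alt_sum n (\<lambda>w. \<Sum>x\<in>T. c x * f x w) v = (\<Sum>x\<in>T. c x * alt_sum n (f x) v)"
  unfolding alt_sum_def by (simp add: sum_distrib_left sum.swap[of _ T] mult.left_commute)

lemma alt_sum_cmult: "alt_sum n (\<lambda>w. c * f w) v = c * alt_sum n f v"
  unfolding alt_sum_def by (simp add: sum_distrib_left mult.left_commute)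

lemma card_permutes_lessThan: "card {\<sigma>. \<sigma> permutes {..<n::nat}} = fact n"
  by (rule card_permutations) auto

section \<open>Wedge products of alternations\<close>

text \<open>An injective relabelling turns a transposition into a transposition, so the sign is
  preserved by induction along a product of transpositions.\<close>

lemma sign_map_permutation:
  assumes "\<sigma> permutes S" "finite S" "inj_on f S"
  shows "sign (map_permutation S f \<sigma>) = sign \<sigma>"
  using assms(1,2)
proof (induction rule: permutes_induct)
  case id
  then show ?case by (simp add: map_permutation_id'[unfolded id_def] map_permutation_id' assms)
next
  case (swap a b p)
  have p: "p permutes S" by fact
  have q: "map_permutation S f p permutes f ` S"
    using map_permutation_permutes[OF inj_on_imp_bij_betw[OF assms(3)] p] .
  have "map_permutation S f (Transposition.transpose a b \<circ> p) = Transposition.transpose (f a) (f b) \<circ> map_permutation S f p"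
    using swap assms(3) permutes_image[OF p]
    by (simp add: map_permutation_compose' map_permutation_transpose permutes_swap_id)
  moreover have "permutation (map_permutation S f p)" "permutation p"
    using q p assms(2) by (auto simp: permutation_permutes)
  moreover have "f a = f b \<longleftrightarrow> a = b"
    using swap assms(3) by (auto dest: inj_onD)
  ultimately show ?case
    using swap by (simp only: sign_compose permutation_swap_id sign_swap_id)
qed

text \<open>The outer alternation absorbs the inner ones: a pair of permutations, one of the first
  \<open>r\<close> and one of the last \<open>s\<close> slots, changes the outer sum only by its
  sign, which cancels the sign in the inner sums. The \<open>fact r * fact s\<close> pairs thus
  contribute equally and cancel the inner denominators. The hypothesis on \<open>f\<close> ensures
  that moving the slots from \<open>r\<close> on leaves \<open>f\<close> unaffected.\<close>

lemma wedge_alt_sum: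
  assumes f: "depends_below r f"
  shows "wedge r s (\<lambda>v. alt_sum r f v / fact r) (\<lambda>v. alt_sum s g v / fact s) =
    (\<lambda>v. alt_sum (r + s) (\<lambda>w. f w * g (\<lambda>i. w (r + i))) v / fact (r + s))"
proof
  fix v :: "nat \<Rightarrow> 'a"
  let ?h = "\<lambda>w. f w * g (\<lambda>i. w (r + i))"
  let ?R = "{\<rho>. \<rho> permutes {..<r}}" and ?S = "{\<tau>. \<tau> permutes {..<s}}"
  \<comment> \<open>\<open>?sh \<tau>\<close> acts like \<open>\<tau>\<close> on the block of the
    last \<open>s\<close> slots and fixes everything else.\<close>
  let ?sh = "map_permutation {..<s} ((+) r)"
  have bij: "bij_betw ((+) r) {..<s} {r..<r+s}"
    by (simp add: bij_betw_def image_add_atLeastLessThan lessThan_atLeast0 add.commute)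
  have sh: "?sh \<tau> permutes {..<r+s}" "sign (?sh \<tau>) = sign \<tau>" "\<And>i. ?sh \<tau> (r + i) = r + \<tau> i"
    "\<And>i. i < r \<Longrightarrow> ?sh \<tau> i = i"
    if "\<tau> permutes {..<s}" for \<tau>
  proof -
    have p: "?sh \<tau> permutes {r..<r+s}" using map_permutation_permutes[OF bij that] .
    then show "?sh \<tau> permutes {..<r+s}" by (rule permutes_subset) auto
    show "sign (?sh \<tau>) = sign \<tau>" using that by (simp add: sign_map_permutation)
    show "?sh \<tau> (r + i) = r + \<tau> i" for i
    proof (cases "i < s")
      case True then show ?thesis by (simp add: map_permutation_apply)
    next
      case False then show ?thesis using permutes_not_in[OF p] permutes_not_in[OF that] by simp
    qed
    show "?sh \<tau> i = i" if "i < r" for i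
      using permutes_not_in[OF p] that by simp
  qed
  have "alt_sum (r + s) (\<lambda>w. alt_sum r f w * alt_sum s g (\<lambda>i. w (r + i))) v =
    alt_sum (r + s) (\<lambda>w. \<Sum>\<rho>\<in>?R. of_int (sign \<rho>) * (\<Sum>\<tau>\<in>?S. of_int (sign \<tau>) *
        (f (\<lambda>i. w (\<rho> i)) * g (\<lambda>i. w (r + \<tau> i))))) v"
    unfolding alt_sum_def[of r] alt_sum_def[of s] sum_product
    by (intro arg_cong2[where f = "alt_sum (r + s)"] ext refl sum.cong)
      (simp add: sum_distrib_left mult_ac)
  also have "\<dots> = (\<Sum>\<rho>\<in>?R. of_int (sign \<rho>) * (\<Sum>\<tau>\<in>?S. of_int (sign \<tau>) *
       alt_sum (r + s) (\<lambda>w. f (\<lambda>i. w (\<rho> i)) * g (\<lambda>i. w (r + \<tau> i))) v))"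
    by (simp only: alt_sum_sum)
  also have "\<dots> = (\<Sum>\<rho>\<in>?R. \<Sum>\<tau>\<in>?S. alt_sum (r + s) ?h v)"
    unfolding sum_distrib_left
  proof (intro sum.cong refl)
    fix \<rho> \<tau> assume *: "\<rho> \<in> ?R" "\<tau> \<in> ?S"
    then have \<rho>: "\<rho> permutes {..<r+s}" by (auto intro: permutes_lessThan_mono)
    have \<tau>: "\<tau> permutes {..<s}" using * by simp
    have \<rho>r: "\<rho> (r + i) = r + i" for i using * permutes_not_in[of \<rho> "{..<r}" "r + i"] by simp
    have \<rho>l: "\<rho> i < r" if "i < r" for i using * that permutes_in_image[of \<rho> "{..<r}" i] by simp
    have "alt_sum (r + s) (\<lambda>w. f (\<lambda>i. w (\<rho> i)) * g (\<lambda>i. w (r + \<tau> i))) v =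
        alt_sum (r + s) (\<lambda>w. ?h (\<lambda>i. w ((?sh \<tau> \<circ> \<rho>) i))) v"
      using sh[OF \<tau>] \<rho>r \<rho>l by (simp cong: depends_belowD[OF f])
    also have "\<dots> = of_int (sign (?sh \<tau> \<circ> \<rho>)) * alt_sum (r + s) ?h v"
      by (rule alt_sum_perm_arg) (intro permutes_compose \<rho> sh[OF \<tau>])
    also have "sign (?sh \<tau> \<circ> \<rho>) = sign \<tau> * sign \<rho>"
      using permutes_lessThan_permutation \<rho> sh[OF \<tau>] by (metis sign_compose)
    finally show "of_int (sign \<rho>) * (of_int (sign \<tau>) *
       alt_sum (r + s) (\<lambda>w. f (\<lambda>i. w (\<rho> i)) * g (\<lambda>i. w (r + \<tau> i))) v) = alt_sum (r + s) ?h v"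
      by (simp flip: mult.assoc of_int_mult)
  qed
  also have "\<dots> = fact r * fact s * alt_sum (r + s) ?h v"
    by (simp add: card_permutes_lessThan)
  finally have main: "alt_sum (r + s) (\<lambda>w. alt_sum r f w * alt_sum s g (\<lambda>i. w (r + i))) v
     = fact r * fact s * alt_sum (r + s) ?h v" .
  have "wedge r s (\<lambda>v. alt_sum r f v / fact r) (\<lambda>v. alt_sum s g v / fact s) v =
    alt_sum (r + s) (\<lambda>w. (1 / (fact r * fact s)) * (alt_sum r f w * alt_sum s g (\<lambda>i. w (r + i)))) v / fact (r + s)"
    unfolding wedge_def alt_sum_def[of "r + s"] by (simp add: mult.assoc)
  then show "wedge r s (\<lambda>v. alt_sum r f v / fact r) (\<lambda>v. alt_sum s g v / fact s) v =
    alt_sum (r + s) ?h v / fact (r + s)"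
    unfolding alt_sum_cmult main by simp
qed

section \<open>Evaluation on vectors that pair off\<close>

lemma alt_sum_0: "alt_sum 0 f = f"
  by (rule ext) (simp add: alt_sum_def)

lemma permutes_lessThan_1: "{\<sigma>. \<sigma> permutes {..<Suc 0}} = {id}"
  by (auto simp: lessThan_Suc)

lemma alt_sum_1: "alt_sum (Suc 0) f = f"
  by (rule ext) (simp add: alt_sum_def permutes_lessThan_1)

text \<open>The permutations of \<open>{..<Suc m}\<close> that fix \<open>m\<close> are exactly the
  permutations of \<open>{..<m}\<close>. The function \<open>f\<close> may still read entry
  \<open>m\<close>, which is then always \<open>v m\<close>.\<close>

lemma alt_sum_peel:
  assumes "\<And>\<sigma>. \<sigma> permutes {..<Suc m} \<Longrightarrow> \<sigma> m \<noteq> m \<Longrightarrow> f (\<lambda>i. v (\<sigma> i)) = 0"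
  shows "alt_sum (Suc m) f v = alt_sum m f v"
  unfolding alt_sum_def
proof (rule sum.mono_neutral_right)
  show "{\<sigma>. \<sigma> permutes {..<m}} \<subseteq> {\<sigma>. \<sigma> permutes {..<Suc m}}"
    by (auto intro: permutes_lessThan_mono)
  have "\<sigma> permutes {..<m}" if "\<sigma> permutes {..<Suc m}" "\<sigma> m = m" for \<sigma>
    by (rule permutes_superset[OF that(1)]) (use that(2) in auto)
  then show "\<forall>\<sigma>\<in>{\<sigma>. \<sigma> permutes {..<Suc m}} - {\<sigma>. \<sigma> permutes {..<m}}.
      of_int (sign \<sigma>) * f (\<lambda>i. v (\<sigma> i)) = 0"
    using assms by auto
qed (auto simp: finite_permutations)

text \<open>A skew bilinear form is its own alternation, which gives it the shape demanded by
  \<open>wedge_alt_sum\<close>.\<close>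

lemma alt_sum_2:
  assumes b: "\<And>u v. b u v = - b v u"
  shows "alt_sum 2 (form2 b) v / fact 2 = form2 b v"
proof -
  have "{\<sigma>. \<sigma> permutes {..<2::nat}} = {id, Transposition.transpose 0 1}"
  proof (intro equalityI subsetI)
    fix \<sigma> :: "nat \<Rightarrow> nat" assume "\<sigma> \<in> {\<sigma>. \<sigma> permutes {..<2}}"
    then have "\<sigma> permutes {0, 1}" by (simp add: numeral_2_eq_2 lessThan_Suc insert_commute)
    then show "\<sigma> \<in> {id, Transposition.transpose 0 1}" by (simp add: permutes_doubleton_iff)
  qed (auto intro: permutes_swap_id)
  moreover have "id \<noteq> Transposition.transpose (0::nat) 1"
    by (metis id_apply transpose_apply_first zero_neq_one)
  ultimately show ?thesis
    using b[of "v 1" "v 0"] by (simp add: alt_sum_def form2_def sign_swap_id)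
qed

text \<open>A permutation contributes only if every factor \<open>b\<close> receives two partners.
  Induction on \<open>m\<close>: the last vector can occupy any of the \<open>2 * m\<close> slots of
  the product, all with the same contribution; its partner is then forced into the neighbouring
  slot, and this factor yields \<open>c\<close>.\<close>

lemma alt_sum_pairs:
  fixes b :: "'e \<Rightarrow> 'e \<Rightarrow> real"
  assumes F: "depends_below N F" and skew: "\<And>x y. b x y = - b y x"
    and "\<And>i j. i < N + 2 * m \<Longrightarrow> j < N + 2 * m \<Longrightarrow> b (v i) (v j) \<noteq> 0 \<Longrightarrow>
      \<exists>l<m. i = N + 2 * l \<and> j = N + 2 * l + 1 \<or> i = N + 2 * l + 1 \<and> j = N + 2 * l"
    and "\<And>l. l < m \<Longrightarrow> b (v (N + 2 * l)) (v (N + 2 * l + 1)) = c"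
  shows "alt_sum (N + 2 * m) (\<lambda>w. F w * (\<Prod>i<m. b (w (N + 2 * i)) (w (N + 2 * i + 1)))) v
    = 2 ^ m * fact m * c ^ m * alt_sum N F v"
  using assms(3,4)
proof (induction m)
  case 0
  then show ?case by simp
next
  case (Suc m)
  let ?t = "Transposition.transpose"
  let ?n = "N + 2 * Suc m" and ?last = "N + 2 * m + 1"
  let ?P = "\<lambda>m w. \<Prod>i<m. b (w (N + 2 * i)) (w (N + 2 * i + 1))"
  let ?f = "\<lambda>w. F w * ?P (Suc m) w"
  let ?T = "\<lambda>\<sigma>. of_int (sign \<sigma>) * ?f (\<lambda>i. v (\<sigma> i))"
  let ?A = "{\<sigma>. \<sigma> permutes {..<?n}}"
  have factor: "b (v (\<sigma> (N + 2 * i))) (v (\<sigma> (N + 2 * i + 1))) \<noteq> 0" if "?T \<sigma> \<noteq> 0" "i < Suc m" for \<sigma> i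
    using that by (auto simp del: prod.lessThan_Suc)
  \<comment> \<open>A reindexing \<open>\<tau>\<close> that preserves the signed summand carries the
    permutations with the last vector in the last slot to those with it in slot
    \<open>l\<close>.\<close>
  have invariant: "(\<Sum>\<sigma>\<in>?A. if \<sigma> l = ?last then ?T \<sigma> else 0) = (\<Sum>\<sigma>\<in>?A. if \<sigma> ?last = ?last then ?T \<sigma> else 0)"
    if \<tau>: "\<tau> permutes {..<?n}" "\<tau> l = ?last" "\<And>w. of_int (sign \<tau>) * ?f (\<lambda>i. w (\<tau> i)) = ?f w" for l \<tau>
  proof -
    have "(\<Sum>\<sigma>\<in>?A. if \<sigma> ?last = ?last then ?T \<sigma> else 0) =
        (\<Sum>\<sigma>\<in>?A. if (\<sigma> \<circ> \<tau>) l = ?last then ?T \<sigma> else 0)"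
      using \<tau>(2) by simp
    also have "\<dots> = (\<Sum>\<sigma>\<in>?A. if (\<sigma> \<circ> \<tau>) l = ?last then ?T (\<sigma> \<circ> \<tau>) else 0)"
    proof (intro sum.cong refl if_cong)
      fix \<sigma> assume "\<sigma> \<in> ?A"
      then have "sign (\<sigma> \<circ> \<tau>) = sign \<sigma> * sign \<tau>"
        using sign_compose permutes_lessThan_permutation \<tau>(1) by blast
      then show "?T \<sigma> = ?T (\<sigma> \<circ> \<tau>)"
        using \<tau>(3)[of "\<lambda>i. v (\<sigma> i)"] by (simp only: of_int_mult mult.assoc o_apply)
    qed
    also have "\<dots> = (\<Sum>\<sigma>\<in>?A. if \<sigma> l = ?last then ?T \<sigma> else 0)"
      by (rule sum_permutations_compose_right[OF \<tau>(1), symmetric])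
    finally show ?thesis by (rule sym)
  qed
  text \<open>Exchanging two factors of the product, or the two arguments of one factor, does not change
    the signed summand. Hence all \<open>2 (m + 1)\<close> places where the last vector can occur contribute
    the same amount, and it suffices to consider the permutations that fix the last index.\<close>
  have slot: "(\<Sum>\<sigma>\<in>?A. if \<sigma> l = ?last then ?T \<sigma> else 0) = (\<Sum>\<sigma>\<in>?A. if \<sigma> ?last = ?last then ?T \<sigma> else 0)"
    if l: "N \<le> l" "l < ?n" for l
  proof -
    define i where "i = (l - N) div 2"
    have i: "i < Suc m" "l = N + 2 * i \<or> l = N + 2 * i + 1" using l by (auto simp: i_def)
    \<comment> \<open>Exchanges the \<open>i\<close>-th pair of slots with the last pair. Being a
      product of two transpositions (both trivial if \<open>i = m\<close>), it is even, and it only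
      reorders the factors.\<close>
    let ?\<tau> = "?t (N + 2 * i) (N + 2 * m) \<circ> ?t (N + 2 * i + 1) ?last"
    have \<tau>p: "?\<tau> permutes {..<?n}"
      using i by (intro permutes_compose permutes_swap_id) auto
    have \<tau>v: "?\<tau> (N + 2 * j) = N + 2 * ?t i m j" "?\<tau> (N + 2 * j + 1) = N + 2 * ?t i m j + 1"
      "j < N \<Longrightarrow> ?\<tau> j = j" for j
      by (auto simp: Transposition.transpose_def)
    have \<tau>s: "sign ?\<tau> = 1"
      by (subst sign_compose) (auto simp: permutation_swap_id sign_swap_id)
    have "?P (Suc m) (\<lambda>i. w (?\<tau> i)) = ?P (Suc m) w" for w
    proof -
      have "?t i m permutes {..<Suc m}" using i by (intro permutes_swap_id) auto
      from prod.permute[OF this, of "\<lambda>i. b (w (N + 2 * i)) (w (N + 2 * i + 1))"] show ?thesis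
        by (simp only: \<tau>v[unfolded o_apply] o_def)
    qed
    moreover have "F (\<lambda>i. w (?\<tau> i)) = F w" for w
      by (rule depends_belowD[OF F]) (simp only: \<tau>v(3))
    ultimately have \<tau>f: "of_int (sign ?\<tau>) * ?f (\<lambda>i. w (?\<tau> i)) = ?f w" for w
      by (simp only: \<tau>s of_int_1 mult_1)
    \<comment> \<open>Exchanges the two slots of the \<open>i\<close>-th factor; the sign from
      skewness offsets the sign of the transposition.\<close>
    let ?\<rho> = "?t (N + 2 * i) (N + 2 * i + 1)"
    have \<rho>p: "?\<rho> permutes {..<?n}"
      using i by (intro permutes_swap_id) auto
    have \<rho>f: "?f (\<lambda>i. w (?\<rho> i)) = - ?f w" for w
    proof -
      have "F (\<lambda>i. w (?\<rho> i)) = F w"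
        by (rule depends_belowD[OF F]) (simp add: Transposition.transpose_def)
      moreover have "?P (Suc m) (\<lambda>i. w (?\<rho> i)) =
        (\<Prod>j<Suc m. (if j = i then -1 else 1) * b (w (N + 2 * j)) (w (N + 2 * j + 1)))"
      proof (intro prod.cong refl)
        fix j
        have "?\<rho> (N + 2 * j) = (if j = i then N + 2 * j + 1 else N + 2 * j)"
          "?\<rho> (N + 2 * j + 1) = (if j = i then N + 2 * j else N + 2 * j + 1)"
          by (auto simp: Transposition.transpose_def)
        then show "b (w (?\<rho> (N + 2 * j))) (w (?\<rho> (N + 2 * j + 1))) =
            (if j = i then -1 else 1) * b (w (N + 2 * j)) (w (N + 2 * j + 1))"
          using skew[of "w (N + 2 * j)" "w (N + 2 * j + 1)"] by simp
      qed
      ultimately show ?thesis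
        using i by (simp add: prod.distrib prod.delta del: prod.lessThan_Suc)
    qed
    from i(2) show ?thesis
    proof
      assume l: "l = N + 2 * i + 1"
      show ?thesis
        by (rule invariant[OF \<tau>p _ \<tau>f]) (unfold l \<tau>v, simp)
    next
      assume l: "l = N + 2 * i"
      show ?thesis
      proof (rule invariant[of "?\<tau> \<circ> ?\<rho>"])
        show "?\<tau> \<circ> ?\<rho> permutes {..<?n}" by (intro permutes_compose \<tau>p \<rho>p)
        have "?\<rho> l = N + 2 * i + 1" using l by simp
        then show "(?\<tau> \<circ> ?\<rho>) l = ?last" using \<tau>v(2)[of i] by (simp only: o_apply transpose_apply_first)
        have "sign (?\<tau> \<circ> ?\<rho>) = -1"
          by (subst sign_compose[OF permutes_lessThan_permutation[OF \<tau>p] permutes_lessThan_permutation[OF \<rho>p]])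
            (simp only: \<tau>s sign_swap_id, simp)
        moreover have "?f (\<lambda>i. w ((?\<tau> \<circ> ?\<rho>) i)) = - ?f w" for w
          using \<rho>f[of "\<lambda>i. w (?\<tau> i)"] \<tau>f[of w] unfolding \<tau>s by (simp only: o_apply of_int_1 mult_1)
        ultimately show "of_int (sign (?\<tau> \<circ> ?\<rho>)) * ?f (\<lambda>i. w ((?\<tau> \<circ> ?\<rho>) i)) = ?f w" for w
          by (simp only: of_int_minus of_int_1 minus_mult_minus mult_1)
      qed
    qed
  qed
  \<comment> \<open>The last vector never lands in a slot of \<open>F\<close>: if no factor
    vanishes, \<open>\<sigma>\<close> maps the slots from \<open>N\<close> on into themselves, hence
    onto themselves, so the last index is already taken there.\<close>
  have out: "(\<Sum>\<sigma>\<in>?A. if \<sigma> l = ?last then ?T \<sigma> else 0) = 0" if l: "l < N" for l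
  proof (rule sum.neutral, intro ballI)
    fix \<sigma> assume \<sigma>: "\<sigma> \<in> ?A"
    have inj: "inj \<sigma>" using \<sigma> permutes_inj by auto
    have lt: "\<sigma> i < ?n" if "i < ?n" for i using \<sigma> that permutes_in_image[of \<sigma> "{..<?n}" i] by simp
    have False if "\<sigma> l = ?last" "?T \<sigma> \<noteq> 0"
    proof -
      have "\<sigma> j \<in> {N..<?n}" if j: "j \<in> {N..<?n}" for j
      proof -
        define i where "i = (j - N) div 2"
        have i: "i < Suc m" "j = N + 2 * i \<or> j = N + 2 * i + 1" using j by (auto simp: i_def)
        have "\<exists>l<Suc m. \<sigma> (N + 2 * i) = N + 2 * l \<and> \<sigma> (N + 2 * i + 1) = N + 2 * l + 1 \<or>
            \<sigma> (N + 2 * i) = N + 2 * l + 1 \<and> \<sigma> (N + 2 * i + 1) = N + 2 * l"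
          using i by (intro Suc.prems(1)[OF lt lt factor[OF \<open>?T \<sigma> \<noteq> 0\<close> i(1)]]) auto
        then show ?thesis using i(2) by auto
      qed
      then have "\<sigma> ` {N..<?n} = {N..<?n}"
        by (intro endo_inj_surj inj_on_subset[OF inj]) auto
      moreover have "?last \<in> {N..<?n}" by simp
      ultimately obtain j where "j \<in> {N..<?n}" "\<sigma> j = ?last" by (metis imageE)
      then have "j = l" using that(1) inj by (metis injD)
      then show False using l \<open>j \<in> _\<close> by simp
    qed
    then show "(if \<sigma> l = ?last then ?T \<sigma> else 0) = 0" by metis
  qed
  have rest: "(\<Sum>\<sigma>\<in>?A. if \<sigma> ?last = ?last then ?T \<sigma> else 0) = alt_sum (Suc (N + 2 * m)) ?f v"
    unfolding alt_sum_def
  proof (rule sum.mono_neutral_cong_right)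
    have "\<sigma> permutes {..<Suc (N + 2 * m)}" if "\<sigma> permutes {..<?n}" "\<sigma> ?last = ?last" for \<sigma>
      by (rule permutes_superset[OF that(1)]) (use that(2) in auto)
    then show "\<forall>\<sigma>\<in>?A - {\<sigma>. \<sigma> permutes {..<Suc (N + 2 * m)}}. (if \<sigma> ?last = ?last then ?T \<sigma> else 0) = 0"
      by auto
    show "(if \<sigma> ?last = ?last then ?T \<sigma> else 0) = ?T \<sigma>"
      if "\<sigma> \<in> {\<sigma>. \<sigma> permutes {..<Suc (N + 2 * m)}}" for \<sigma>
      using that permutes_not_in[of \<sigma> "{..<Suc (N + 2 * m)}" ?last] by simp
  qed (auto simp: finite_permutations intro: permutes_lessThan_mono)
  \<comment> \<open>The permutations are sorted by the unique slot \<open>l\<close> that holds the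
    last vector.\<close>
  have "alt_sum ?n ?f v = (\<Sum>\<sigma>\<in>?A. \<Sum>l<?n. if \<sigma> l = ?last then ?T \<sigma> else 0)"
    unfolding alt_sum_def
  proof (intro sum.cong refl)
    fix \<sigma> assume \<sigma>: "\<sigma> \<in> ?A"
    then have "?last \<in> \<sigma> ` {..<?n}" using permutes_image[of \<sigma> "{..<?n}"] by simp
    then obtain l0 where l0: "l0 < ?n" "\<sigma> l0 = ?last" by (metis imageE lessThan_iff)
    have "inj \<sigma>" using \<sigma> permutes_inj by auto
    then have "\<sigma> l = ?last \<longleftrightarrow> l = l0" for l using l0(2) by (metis injD)
    then show "?T \<sigma> = (\<Sum>l<?n. if \<sigma> l = ?last then ?T \<sigma> else 0)"
      using l0 by (simp add: sum.delta)
  qed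
  also have "\<dots> = (\<Sum>l<?n. \<Sum>\<sigma>\<in>?A. if \<sigma> l = ?last then ?T \<sigma> else 0)"
    by (rule sum.swap)
  also have "\<dots> = (\<Sum>l\<in>{N..<?n}. \<Sum>\<sigma>\<in>?A. if \<sigma> l = ?last then ?T \<sigma> else 0)"
  proof (rule sum.mono_neutral_right, simp, force, intro ballI)
    fix l assume "l \<in> {..<?n} - {N..<?n}"
    then have "l < N" by auto
    then show "(\<Sum>\<sigma>\<in>?A. if \<sigma> l = ?last then ?T \<sigma> else 0) = 0" by (rule out)
  qed
  also have "\<dots> = (\<Sum>l\<in>{N..<?n}. alt_sum (Suc (N + 2 * m)) ?f v)"
    unfolding rest[symmetric] by (intro sum.cong refl slot) auto
  also have "\<dots> = 2 * real (Suc m) * alt_sum (Suc (N + 2 * m)) ?f v"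
    by simp
  \<comment> \<open>With the last vector in the last slot, the other argument of the same factor
    must be its partner, so a second index can be peeled off.\<close>
  also have "alt_sum (Suc (N + 2 * m)) ?f v = alt_sum (N + 2 * m) ?f v"
  proof (rule alt_sum_peel, rule ccontr)
    fix \<sigma> assume \<sigma>: "\<sigma> permutes {..<Suc (N + 2 * m)}" "\<sigma> (N + 2 * m) \<noteq> N + 2 * m" "?f (\<lambda>i. v (\<sigma> i)) \<noteq> 0"
    have last: "\<sigma> ?last = ?last" using \<sigma>(1) permutes_not_in by fastforce
    have lt: "\<sigma> (N + 2 * m) < ?n" using permutes_in_image[OF \<sigma>(1), of "N + 2 * m"] by simp
    have "b (v (\<sigma> (N + 2 * m))) (v (\<sigma> ?last)) \<noteq> 0"
      using factor[of \<sigma> m] \<sigma>(3) by simp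
    then have "b (v (\<sigma> (N + 2 * m))) (v ?last) \<noteq> 0" unfolding last .
    have "?last < ?n" by simp
    from Suc.prems(1)[OF lt this \<open>b _ (v ?last) \<noteq> 0\<close>] obtain l where
      "\<sigma> (N + 2 * m) = N + 2 * l \<and> ?last = N + 2 * l + 1 \<or> \<sigma> (N + 2 * m) = N + 2 * l + 1 \<and> ?last = N + 2 * l"
      by auto
    then show False using \<sigma>(2) by presburger
  qed
  also have "alt_sum (N + 2 * m) ?f v = alt_sum (N + 2 * m) (\<lambda>w. c * (F w * ?P m w)) v"
    unfolding alt_sum_def
  proof (intro sum.cong refl, rule arg_cong2[where f = "(*)", OF refl])
    fix \<sigma> assume "\<sigma> \<in> {\<sigma>. \<sigma> permutes {..<N + 2 * m}}"
    then have "\<sigma> (N + 2 * m) = N + 2 * m" "\<sigma> ?last = ?last"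
      by (auto intro: permutes_not_in)
    then show "?f (\<lambda>i. v (\<sigma> i)) = c * (F (\<lambda>i. v (\<sigma> i)) * ?P m (\<lambda>i. v (\<sigma> i)))"
      using Suc.prems(2)[of m] by simp
  qed
  also have "\<dots> = c * (2 ^ m * fact m * c ^ m * alt_sum N F v)"
    unfolding alt_sum_cmult
  proof (intro arg_cong2[where f = "(*)"] refl Suc.IH)
    show "\<exists>l<m. i = N + 2 * l \<and> j = N + 2 * l + 1 \<or> i = N + 2 * l + 1 \<and> j = N + 2 * l"
      if ij: "i < N + 2 * m" "j < N + 2 * m" "b (v i) (v j) \<noteq> 0" for i j
    proof -
      have "\<exists>l<Suc m. i = N + 2 * l \<and> j = N + 2 * l + 1 \<or> i = N + 2 * l + 1 \<and> j = N + 2 * l"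
        by (rule Suc.prems(1)[OF _ _ ij(3)]) (use ij in auto)
      then show ?thesis using ij(1,2) by (auto simp: less_Suc_eq)
    qed
    show "b (v (N + 2 * l)) (v (N + 2 * l + 1)) = c" if "l < m" for l
      using Suc.prems(2) that by simp
  qed
  finally show ?case by (simp add: mult_ac)
qed

section \<open>The wedge products of the theorem as alternations\<close>

lemma wedge_power2_eq_alt_sum:
  assumes skew: "\<And>x y. b x y = - b y x"
  shows "wedge_power2 (form2 b) m =
    (\<lambda>v. alt_sum (2 * m) (\<lambda>w. \<Prod>i<m. b (w (2 * i)) (w (2 * i + 1))) v / fact (2 * m))"
proof (induction m)
  case 0
  then show ?case by (simp add: alt_sum_0)
next
  case (Suc m)
  have "form2 b = (\<lambda>v. alt_sum 2 (form2 b) v / fact 2)"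
    using alt_sum_2[of b, OF skew] by (intro ext) simp
  moreover have "depends_below 2 (form2 b)"
    by (simp add: depends_below_def form2_def)
  ultimately have "wedge_power2 (form2 b) (Suc m) = (\<lambda>v. alt_sum (2 + 2 * m)
      (\<lambda>w. form2 b w * (\<Prod>i<m. b (w (2 + 2 * i)) (w (2 + (2 * i + 1))))) v / fact (2 + 2 * m))"
    using wedge_alt_sum[of 2 "form2 b" "2 * m"] Suc.IH by simp
  moreover have "(\<lambda>w. form2 b w * (\<Prod>i<m. b (w (2 + 2 * i)) (w (2 + (2 * i + 1))))) =
      (\<lambda>w. \<Prod>i<Suc m. b (w (2 * i)) (w (2 * i + 1)))"
    by (simp add: form2_def prod.lessThan_Suc_shift del: prod.lessThan_Suc)
  ultimately show ?case
    by simp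
qed

text \<open>By the Leibniz formula the right-hand side is the determinant of the matrix
  \<open>\<theta> i (v j)\<close> divided by \<open>fact n\<close>.\<close>

lemma wedge_coframe_eq_alt_sum:
  "wedge_coframe \<theta> n = (\<lambda>v. alt_sum n (\<lambda>w. \<Prod>i<n. \<theta> i (w i)) v / fact n)"
proof (induction n)
  case 0
  then show ?case by (simp add: alt_sum_0)
next
  case (Suc n)
  have "depends_below n (\<lambda>w. \<Prod>i<n. \<theta> i (w i))"
    by (auto simp: depends_below_def intro!: prod.cong)
  moreover have "form1 (\<theta> n) = (\<lambda>v. alt_sum 1 (form1 (\<theta> n)) v / fact 1)"
    by (simp add: alt_sum_1)
  ultimately have "wedge_coframe \<theta> (Suc n) = (\<lambda>v. alt_sum (n + 1)
      (\<lambda>w. (\<Prod>i<n. \<theta> i (w i)) * form1 (\<theta> n) (\<lambda>i. w (n + i))) v / fact (n + 1))"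
    using wedge_alt_sum[of n "\<lambda>w. \<Prod>i<n. \<theta> i (w i)" 1 "form1 (\<theta> n)"] Suc.IH by simp
  then show ?case
    by (simp add: form1_def)
qed

text \<open>The tensor whose alternation is the contact pair form. Slot \<open>0\<close> belongs to
  \<open>a\<close>, the next \<open>2 * h\<close> slots to \<open>b\<close>, slot
  \<open>2 * h + 1\<close> to \<open>a'\<close>, and those from \<open>2 * h + 2\<close> on to
  \<open>b'\<close>.\<close>

definition contact_tensor ::
    "nat \<Rightarrow> nat \<Rightarrow> ('e \<Rightarrow> real) \<Rightarrow> ('e \<Rightarrow> 'e \<Rightarrow> real) \<Rightarrow> ('e \<Rightarrow> real) \<Rightarrow> ('e \<Rightarrow> 'e \<Rightarrow> real) \<Rightarrow> 'e form" where
  "contact_tensor h k a b a' b' w =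
     a (w 0) * (\<Prod>i<h. b (w (1 + 2 * i)) (w (1 + 2 * i + 1))) * a' (w (2 * h + 1)) *
     (\<Prod>i<k. b' (w (2 * h + 2 + 2 * i)) (w (2 * h + 2 + 2 * i + 1)))"

lemma wedge_form1_power2:
  assumes skew: "\<And>x y. b x y = - b y x"
  shows "wedge 1 (2 * m) (form1 a) (wedge_power2 (form2 b) m) =
    (\<lambda>v. alt_sum (2 * m + 1) (\<lambda>w. a (w 0) * (\<Prod>i<m. b (w (1 + 2 * i)) (w (1 + 2 * i + 1)))) v / fact (2 * m + 1))"
proof -
  have a: "(\<lambda>v. alt_sum 1 (form1 a) v / fact 1) = form1 a"
    by (simp add: alt_sum_1)
  have "depends_below 1 (form1 a)"
    by (simp add: depends_below_def form1_def)
  from wedge_alt_sum[OF this, of "2 * m" "\<lambda>w. \<Prod>i<m. b (w (2 * i)) (w (2 * i + 1))", unfolded a]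
  show ?thesis
    unfolding wedge_power2_eq_alt_sum[of b, OF skew] by (simp only: form1_def add.commute[of "2 * m" 1] add.assoc)
qed

lemma wedge_contact_tensor:
  assumes skew: "\<And>x y. b x y = - b y x" "\<And>x y. b' x y = - b' y x"
  shows "wedge (2 * h + 1) (2 * k + 1)
      (wedge 1 (2 * h) (form1 a) (wedge_power2 (form2 b) h))
      (wedge 1 (2 * k) (form1 a') (wedge_power2 (form2 b') k)) =
    (\<lambda>v. alt_sum (2 * h + 2 * k + 2) (contact_tensor h k a b a' b') v / fact (2 * h + 2 * k + 2))"
proof -
  let ?f = "\<lambda>w. a (w 0) * (\<Prod>i<h. b (w (1 + 2 * i)) (w (1 + 2 * i + 1)))"
  let ?g = "\<lambda>w. a' (w 0) * (\<Prod>i<k. b' (w (1 + 2 * i)) (w (1 + 2 * i + 1)))"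
  have "depends_below (2 * h + 1) ?f"
    by (auto simp: depends_below_def intro!: arg_cong2[where f = "(*)"] prod.cong)
  note * = wedge_alt_sum[OF this, of "2 * k + 1" ?g]
  have "(\<lambda>w. ?f w * ?g (\<lambda>i. w (2 * h + 1 + i))) = contact_tensor h k a b a' b'"
    by (rule ext) (simp add: contact_tensor_def mult.assoc)
  moreover have "2 * h + 1 + (2 * k + 1) = 2 * h + 2 * k + 2" by simp
  ultimately show ?thesis
    using * by (simp only: wedge_form1_power2[of b, OF skew(1)] wedge_form1_power2[of b', OF skew(2)])
qed

section \<open>Alternating forms of top degree\<close>

definition multilinear_form :: "nat \<Rightarrow> 'e::real_vector form \<Rightarrow> bool" where
  "multilinear_form n f \<longleftrightarrow> depends_below n f \<and> (\<forall>j<n. \<forall>w. linear (\<lambda>x. f (w(j := x))))"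

lemma multilinear_form_mult:
  assumes "multilinear_form r f" "multilinear_form s g"
  shows "multilinear_form (r + s) (\<lambda>w. f w * g (\<lambda>i. w (r + i)))"
proof -
  have f: "depends_below r f" "\<And>j w. j < r \<Longrightarrow> linear (\<lambda>x. f (w(j := x)))"
    and g: "depends_below s g" "\<And>j w. j < s \<Longrightarrow> linear (\<lambda>x. g (w(j := x)))"
    using assms unfolding multilinear_form_def by auto
  have "depends_below (r + s) (\<lambda>w. f w * g (\<lambda>i. w (r + i)))"
    unfolding depends_below_def
    by (intro allI impI arg_cong2[where f = "(*)"] depends_belowD[OF f(1)] depends_belowD[OF g(1)]) auto
  moreover have "linear (\<lambda>x. f (w(j := x)) * g (\<lambda>i. (w(j := x)) (r + i)))" if "j < r + s" for j w
  proof (cases "j < r")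
    case True
    then have "(\<lambda>i. (w(j := x)) (r + i)) = (\<lambda>i. w (r + i))" for x by auto
    then show ?thesis
      using linear_compose_scale_right[OF f(2)[OF True]] by (simp add: linear_iff algebra_simps)
  next
    case False
    then have "(\<lambda>i. (w(j := x)) (r + i)) = (\<lambda>i. w (r + i))(j - r := x)" for x
      by (auto simp: fun_eq_iff)
    moreover have "f (w(j := x)) = f w" for x
      by (rule depends_belowD[OF f(1)]) (use False in auto)
    moreover have "linear (\<lambda>x. g ((\<lambda>i. w (r + i))(j - r := x)))"
      using False that by (intro g(2)) auto
    ultimately show ?thesis by (simp add: linear_iff algebra_simps)
  qed
  ultimately show ?thesis
    unfolding multilinear_form_def by blast
qed

lemma multilinear_form1: "linear a \<Longrightarrow> multilinear_form 1 (form1 a)"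
  by (simp add: multilinear_form_def depends_below_def form1_def)

lemma multilinear_prod_form1:
  assumes "\<And>i. i < n \<Longrightarrow> linear (\<theta> i)"
  shows "multilinear_form n (\<lambda>w. \<Prod>i<n. \<theta> i (w i))"
  using assms
proof (induction n)
  case 0
  then show ?case by (simp add: multilinear_form_def depends_below_def)
next
  case (Suc n)
  then show ?case
    using multilinear_form_mult[OF _ multilinear_form1, of n "\<lambda>w. \<Prod>i<n. \<theta> i (w i)" "\<theta> n"]
    by (simp add: form1_def)
qed

lemma multilinear_form2:
  assumes "bilinear b"
  shows "multilinear_form 2 (form2 b)"
proof -
  have "linear (\<lambda>x. form2 b (w(j := x)))" if "j < 2" for j w
    using assms that by (auto simp: form2_def bilinear_def less_2_cases_iff)
  then show ?thesis
    by (simp add: multilinear_form_def depends_below_def form2_def)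
qed

lemma multilinear_prod_form2:
  assumes "bilinear b"
  shows "multilinear_form (2 * m) (\<lambda>w. \<Prod>i<m. b (w (2 * i)) (w (2 * i + 1)))"
proof (induction m)
  case 0
  then show ?case by (simp add: multilinear_form_def depends_below_def)
next
  case (Suc m)
  then show ?case
    using multilinear_form_mult[OF Suc.IH multilinear_form2[OF assms]]
    by (simp add: form2_def add.commute)
qed

lemma multilinear_contact_tensor:
  assumes "linear a" "linear a'" "bilinear b" "bilinear b'"
  shows "multilinear_form (2 * h + 2 * k + 2) (contact_tensor h k a b a' b')"
proof -
  have "multilinear_form (1 + 2 * m)
      (\<lambda>w. form1 c w * (\<Prod>i<m. d (w (1 + 2 * i)) (w (1 + (2 * i + 1)))))"
    if "linear c" "bilinear d" for c d m
    by (rule multilinear_form_mult[OF multilinear_form1[OF that(1)] multilinear_prod_form2[OF that(2)]])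
  from multilinear_form_mult[OF this[OF assms(1,3), of h] this[OF assms(2,4), of k]]
  have "multilinear_form (1 + 2 * h + (1 + 2 * k)) (contact_tensor h k a b a' b')"
    by (rule back_subst[of "multilinear_form _"]) (rule ext, simp add: contact_tensor_def form1_def mult.assoc)
  then show ?thesis by (simp add: add.commute add.left_commute)
qed

lemma multilinear_alt_sum:
  assumes "multilinear_form n f"
  shows "multilinear_form n (alt_sum n f)"
proof -
  have f: "depends_below n f" "\<And>j w. j < n \<Longrightarrow> linear (\<lambda>x. f (w(j := x)))"
    using assms unfolding multilinear_form_def by auto
  have "depends_below n (alt_sum n f)"
    unfolding depends_below_def alt_sum_def
  proof (intro allI impI sum.cong refl arg_cong2[where f = "(*)"] depends_belowD[OF f(1)])
    fix v w :: "nat \<Rightarrow> 'a" and \<sigma> i assume "\<forall>i<n. v i = w i" "\<sigma> \<in> {\<sigma>. \<sigma> permutes {..<n}}" "i < n"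
    then show "v (\<sigma> i) = w (\<sigma> i)" using permutes_in_image[of \<sigma> "{..<n}" i] by simp
  qed
  moreover have "linear (\<lambda>x. alt_sum n f (w(j := x)))" if "j < n" for j w
    unfolding alt_sum_def
  proof (rule linear_compose_sum, intro ballI)
    fix \<sigma> assume \<sigma>: "\<sigma> \<in> {\<sigma>. \<sigma> permutes {..<n}}"
    then have "j \<in> \<sigma> ` {..<n}" using that permutes_image[of \<sigma> "{..<n}"] by simp
    then obtain l where l: "l < n" "\<sigma> l = j" by auto
    have "inj \<sigma>" using \<sigma> permutes_inj by auto
    then have "\<sigma> i = j \<longleftrightarrow> i = l" for i using l(2) by (metis injD)
    then have "(\<lambda>i. (w(j := x)) (\<sigma> i)) = (\<lambda>i. w (\<sigma> i))(l := x)" for x by auto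
    then show "linear (\<lambda>x. of_int (sign \<sigma>) * f (\<lambda>i. (w(j := x)) (\<sigma> i)))"
      using f(2)[OF l(1), of "\<lambda>i. w (\<sigma> i)"] by (simp add: linear_iff algebra_simps)
  qed
  ultimately show ?thesis unfolding multilinear_form_def by blast
qed

lemma alt_sum_repeated:
  assumes "i < n" "j < n" "i \<noteq> j" "v i = v j"
  shows "alt_sum n f v = 0"
proof -
  let ?t = "Transposition.transpose i j"
  have "(\<lambda>l. v (?t l)) = v"
    using assms(4) by (auto simp: Transposition.transpose_def)
  moreover have "?t permutes {..<n}"
    using assms by (intro permutes_swap_id) auto
  ultimately show ?thesis
    using alt_sum_permute[of ?t n f v] assms(3) by (simp add: sign_swap_id)
qed

text \<open>Multilinear expansion in the spanning family \<open>E\<close> reduces to entries taken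
  from \<open>E\<close>. Such a sequence either repeats a vector, which gives zero by antisymmetry,
  or rearranges \<open>E\<close>, which gives the value on \<open>E\<close> up to sign.\<close>

lemma alt_sum_eq_0:
  assumes f: "multilinear_form n f" and E: "\<And>x. x = (\<Sum>i<n. \<theta> i x *\<^sub>R E i)"
    and 0: "alt_sum n f E = 0"
  shows "alt_sum n f v = 0"
proof -
  let ?F = "alt_sum n f"
  have F: "depends_below n ?F" "\<And>j w. j < n \<Longrightarrow> linear (\<lambda>x. ?F (w(j := x)))"
    using multilinear_alt_sum[OF f] unfolding multilinear_form_def by auto
  text \<open>The entries are replaced by basis vectors one at a time, \<open>m\<close> being the number of entries
    that are still arbitrary.\<close>
  have "?F w = 0" if "m \<le> n" "\<And>j. m \<le> j \<Longrightarrow> j < n \<Longrightarrow> w j \<in> E ` {..<n}" for m w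
    using that
  proof (induction m arbitrary: w)
    case 0
    then have "\<forall>j. \<exists>i. j < n \<longrightarrow> i < n \<and> w j = E i" by fastforce
    then obtain \<kappa>' where \<kappa>': "\<And>j. j < n \<Longrightarrow> \<kappa>' j < n \<and> w j = E (\<kappa>' j)" by metis
    \<comment> \<open>Extended by the identity from \<open>n\<close> on, as \<open>permutes\<close>
      demands.\<close>
    define \<kappa> where "\<kappa> j = (if j < n then \<kappa>' j else j)" for j
    have \<kappa>: "\<kappa> j < n" "w j = E (\<kappa> j)" if "j < n" for j using \<kappa>'[OF that] that by (auto simp: \<kappa>_def)
    show ?case
    proof (cases "inj_on \<kappa> {..<n}")
      case True
      then have "\<kappa> ` {..<n} = {..<n}"
        by (intro endo_inj_surj) (auto simp: \<kappa>(1))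
      then have "bij_betw \<kappa> {..<n} {..<n}"
        using True by (simp add: bij_betw_def)
      then have "\<kappa> permutes {..<n}"
        by (rule bij_imp_permutes) (simp add: \<kappa>_def)
      then have "?F (\<lambda>i. E (\<kappa> i)) = 0" using \<open>?F E = 0\<close> by (simp add: alt_sum_permute)
      moreover have "?F w = ?F (\<lambda>i. E (\<kappa> i))" by (rule depends_belowD[OF F(1) \<kappa>(2)])
      ultimately show ?thesis by simp
    next
      case False
      then obtain i j where "i < n" "j < n" "i \<noteq> j" "\<kappa> i = \<kappa> j"
        by (auto simp: inj_on_def)
      then show ?thesis using \<kappa>(2) by (intro alt_sum_repeated[of i n j]) auto
    qed
  next
    case (Suc m)
    then have m: "m < n" by simp
    have "?F w = ?F (w(m := \<Sum>i<n. \<theta> i (w m) *\<^sub>R E i))" using E[of "w m"] by simp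
    also have "\<dots> = (\<Sum>i<n. \<theta> i (w m) * ?F (w(m := E i)))"
      by (simp add: linear_sum[OF F(2)[OF m, of w]] linear_cmul[OF F(2)[OF m, of w]])
    also have "\<dots> = 0"
    proof (intro sum.neutral ballI)
      fix i assume i: "i \<in> {..<n}"
      have "?F (w(m := E i)) = 0"
      proof (rule Suc.IH)
        show "(w(m := E i)) j \<in> E ` {..<n}" if "m \<le> j" "j < n" for j
          using Suc.prems(2)[of j] that i by (cases "j = m") auto
      qed (use m in simp)
      then show "\<theta> i (w m) * ?F (w(m := E i)) = 0" by simp
    qed
    finally show ?case .
  qed
  from this[of n v] show ?thesis by simp
qed

text \<open>Any permutation other than \<open>id\<close> moves some index \<open>i\<close>, and then
  the factor \<open>\<theta> i\<close> vanishes; only the identity term remains.\<close>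

lemma alt_sum_coframe:
  assumes \<theta>: "\<And>i j. i < n \<Longrightarrow> j < n \<Longrightarrow> \<theta> i (E j) = (if i = j then 1 else 0)"
  shows "alt_sum n (\<lambda>w. \<Prod>i<n. \<theta> i (w i)) E = 1"
proof -
  let ?A = "{\<sigma>. \<sigma> permutes {..<n}}"
  have "(\<Prod>i<n. \<theta> i (E (\<sigma> i))) = (if \<sigma> = id then 1 else 0)" if "\<sigma> \<in> ?A" for \<sigma>
  proof (cases "\<sigma> = id")
    case False
    then obtain i where i: "\<sigma> i \<noteq> i" by (metis eq_id_iff)
    then have "i < n" using that permutes_not_in[of \<sigma> "{..<n}" i] by auto
    then have "\<theta> i (E (\<sigma> i)) = 0"
      using i \<theta> that permutes_in_image[of \<sigma> "{..<n}" i] by simp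
    then show ?thesis using False \<open>i < n\<close> by (simp add: prod_zero_iff) blast
  qed (simp add: \<theta>)
  then have "alt_sum n (\<lambda>w. \<Prod>i<n. \<theta> i (w i)) E =
      (\<Sum>\<sigma>\<in>?A. of_int (sign \<sigma>) * (if \<sigma> = id then 1 else 0))"
    unfolding alt_sum_def by (intro sum.cong refl) simp
  also have "\<dots> = (\<Sum>\<sigma>\<in>?A. if \<sigma> = id then of_int (sign \<sigma>) else 0)"
    by (intro sum.cong refl) simp
  also have "\<dots> = 1"
    by (subst sum.delta) (auto simp: finite_permutations permutes_id)
  finally show ?thesis .
qed

text \<open>Top-degree forms make up a line: \<open>f\<close> minus the appropriate multiple of the
  coframe product has an alternation that vanishes on \<open>E\<close>, hence everywhere by
  \<open>alt_sum_eq_0\<close>.\<close>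

lemma alt_sum_eq_coframe:
  assumes f: "multilinear_form n f" and E: "\<And>x. x = (\<Sum>i<n. \<theta> i x *\<^sub>R E i)"
    and \<theta>: "\<And>i. i < n \<Longrightarrow> linear (\<theta> i)"
      "\<And>i j. i < n \<Longrightarrow> j < n \<Longrightarrow> \<theta> i (E j) = (if i = j then 1 else 0)"
  shows "alt_sum n f v = alt_sum n f E * alt_sum n (\<lambda>w. \<Prod>i<n. \<theta> i (w i)) v"
proof -
  let ?p = "\<lambda>w. \<Prod>i<n. \<theta> i (w i)" and ?c = "alt_sum n f E"
  let ?d = "\<lambda>w. f w - ?c * ?p w"
  have *: "alt_sum n ?d w = alt_sum n f w - ?c * alt_sum n ?p w" for w
    unfolding alt_sum_def by (simp add: sum_subtractf sum_distrib_left algebra_simps)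
  have p: "multilinear_form n ?p"
    by (rule multilinear_prod_form1) (rule \<theta>(1))
  have "depends_below n ?d"
    unfolding depends_below_def
  proof (intro allI impI)
    fix v w :: "nat \<Rightarrow> 'a" assume "\<forall>i<n. v i = w i"
    then have "f v = f w" "?p v = ?p w"
      using f p unfolding multilinear_form_def depends_below_def by blast+
    then show "?d v = ?d w" by (simp only:)
  qed
  moreover have "linear (\<lambda>x. ?d (w(j := x)))" if "j < n" for j w
  proof -
    have "linear (\<lambda>x. f (w(j := x)))" "linear (\<lambda>x. ?p (w(j := x)))"
      using f p that unfolding multilinear_form_def by blast+
    then have "linear (\<lambda>x. f (w(j := x)) - ?c *\<^sub>R ?p (w(j := x)))"
      by (intro linear_compose_sub linear_compose_scale_right)
    then show ?thesis by (simp only: real_scaleR_def)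
  qed
  ultimately have "multilinear_form n ?d"
    unfolding multilinear_form_def by blast
  moreover have "alt_sum n ?d E = 0"
    using alt_sum_coframe[of n \<theta> E, OF \<theta>(2)] by (simp add: *)
  ultimately have "alt_sum n ?d v = 0"
    by (rule alt_sum_eq_0[OF _ E])
  with *[of v] show ?thesis by linarith
qed

section \<open>Kernels of skew forms\<close>

text \<open>On the interleaved sequence \<open>p 0, q 0, p 1, q 1, ...\<close> the power of
  \<open>b\<close> is nonzero, by \<open>alt_sum_pairs\<close> with \<open>N = 0\<close> and
  \<open>c = 1\<close>.\<close>

lemma wedge_power2_no_symplectic_family:
  fixes b :: "'e \<Rightarrow> 'e \<Rightarrow> real"
  assumes skew: "\<And>x y. b x y = - b y x"
    and p: "wedge_power2 (form2 b) (Suc m) = (\<lambda>v. 0)"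
    and pq: "\<And>i j. i \<le> m \<Longrightarrow> j \<le> m \<Longrightarrow> b (p i) (p j) = 0 \<and> b (q i) (q j) = 0 \<and>
      b (p i) (q j) = (if i = j then 1 else 0)"
  shows False
proof -
  define v where "v i = (if even i then p (i div 2) else q (i div 2))" for i :: nat
  have "alt_sum (0 + 2 * Suc m) (\<lambda>w. 1 * (\<Prod>i<Suc m. b (w (0 + 2 * i)) (w (0 + 2 * i + 1)))) v
      = 2 ^ Suc m * fact (Suc m) * 1 ^ Suc m * alt_sum 0 (\<lambda>w. 1) v"
  proof (rule alt_sum_pairs)
    show "depends_below 0 (\<lambda>w::nat \<Rightarrow> 'e. 1)" by (simp add: depends_below_def)
    show "b x y = - b y x" for x y by (rule skew)
    show "b (v (0 + 2 * l)) (v (0 + 2 * l + 1)) = 1" if "l < Suc m" for l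
      using that pq[of l l] by (simp add: v_def)
    fix i j assume ij: "i < 0 + 2 * Suc m" "j < 0 + 2 * Suc m" and nz: "b (v i) (v j) \<noteq> 0"
    have le: "i div 2 \<le> m" "j div 2 \<le> m" using ij by auto
    note c = pq[OF le] pq[OF le(2,1)] skew[of "q (i div 2)" "p (j div 2)"]
    have *: "even i \<noteq> even j \<and> i div 2 = j div 2"
      using nz c by (auto simp: v_def split: if_splits)
    show "\<exists>l<Suc m. i = 0 + 2 * l \<and> j = 0 + 2 * l + 1 \<or> i = 0 + 2 * l + 1 \<and> j = 0 + 2 * l"
    proof (rule exI[of _ "i div 2"], intro conjI)
      have "2 * (i div 2) + i mod 2 = i" "2 * (j div 2) + j mod 2 = j" by simp_all
      then show "i = 0 + 2 * (i div 2) \<and> j = 0 + 2 * (i div 2) + 1 \<or> i = 0 + 2 * (i div 2) + 1 \<and> j = 0 + 2 * (i div 2)"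
        using * by (cases "even i") (simp_all add: even_iff_mod_2_eq_zero odd_iff_mod_2_eq_one)
    qed (use le in simp)
  qed
  moreover have "alt_sum (2 * Suc m) (\<lambda>w. \<Prod>i<Suc m. b (w (2 * i)) (w (2 * i + 1))) v = 0"
    using fun_cong[OF p, of v] unfolding wedge_power2_eq_alt_sum[of b, OF skew]
    by (simp del: prod.lessThan_Suc)
  ultimately show False by (simp add: alt_sum_0 del: prod.lessThan_Suc)
qed

text \<open>The set \<open>S\<close> consists of the vectors of a maximal symplectic family.\<close>

lemma skew_form_kernel:
  fixes b :: "'e::real_vector \<Rightarrow> 'e \<Rightarrow> real"
  assumes b: "bilinear b" and skew: "\<And>x y. b x y = - b y x"
    and h: "wedge_power2 (form2 b) (Suc h) = (\<lambda>v. 0)"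
  obtains S where "finite S" "card S \<le> 2 * h" "\<And>u v. (\<And>s. s \<in> S \<Longrightarrow> b s u = 0) \<Longrightarrow> b u v = 0"
proof -
  define symp where "symp m p q \<longleftrightarrow> (\<forall>i<m. \<forall>j<m. b (p i) (p j) = 0 \<and> b (q i) (q j) = 0 \<and>
      b (p i) (q j) = (if i = j then 1 else 0))" for m :: nat and p q :: "nat \<Rightarrow> 'e"
  have "\<not> (\<exists>p q. symp (Suc h) p q)"
    using wedge_power2_no_symplectic_family[of b h, OF skew h] unfolding symp_def less_Suc_eq_le by metis
  moreover have "\<exists>p q. symp 0 p q" by (simp add: symp_def)
  \<comment> \<open>Families of length \<open>Suc h\<close> are excluded, so some
    \<open>m \<le> h\<close> admits a family that has no successor of length
    \<open>Suc m\<close>.\<close>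
  ultimately have "\<exists>m<Suc h. (\<forall>i\<le>m. \<exists>p q. symp i p q) \<and> \<not> (\<exists>p q. symp (Suc m) p q)"
    using ex_least_nat_less[of "\<lambda>m. \<not> (\<exists>p q. symp m p q)" "Suc h"] by auto
  then obtain m p q where m: "m \<le> h" and pq: "symp m p q" and max: "\<not> (\<exists>p q. symp (Suc m) p q)"
    unfolding less_Suc_eq_le by blast
  have l: "linear (b x)" "linear (\<lambda>x. b x y)" for x y
    using b by (auto simp: bilinear_def)
  let ?S = "p ` {..<m} \<union> q ` {..<m}"
  have "card ?S \<le> card {..<m} + card {..<m}"
    using card_Un_le card_image_le[of "{..<m}"] by (meson add_mono finite_lessThan le_trans)
  moreover have "b u v = 0" if u: "\<And>s. s \<in> ?S \<Longrightarrow> b s u = 0" for u v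
  proof (rule ccontr)
    assume nz: "b u v \<noteq> 0"
    \<comment> \<open>The symplectic projection of \<open>v\<close>: subtracting its components
      along the family makes \<open>y\<close> orthogonal to every \<open>p j\<close> and
      \<open>q j\<close> with respect to \<open>b\<close>. As \<open>u\<close> is orthogonal to the
      family as well, \<open>b u y = b u v\<close>.\<close>
    define y where "y = v - (\<Sum>i<m. b (p i) v *\<^sub>R q i - b (q i) v *\<^sub>R p i)"
    have bxy: "b x y = b x v - (\<Sum>i<m. b (p i) v * b x (q i) - b (q i) v * b x (p i))" for x
      unfolding y_def by (simp add: linear_diff[OF l(1)] linear_sum[OF l(1)] linear_cmul[OF l(1)])
    have py: "b (p j) y = 0" if "j < m" for j
    proof -
      have "(\<Sum>i<m. b (p i) v * b (p j) (q i) - b (q i) v * b (p j) (p i)) =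
          (\<Sum>i<m. if i = j then b (p i) v else 0)"
        using pq that by (intro sum.cong refl) (auto simp: symp_def)
      then show ?thesis using that by (simp add: bxy)
    qed
    have qy: "b (q j) y = 0" if "j < m" for j
    proof -
      have "b (q j) (p i) = (if i = j then - 1 else 0)" if "i < m" for i
        using pq that \<open>j < m\<close> skew[of "q j" "p i"] by (simp add: symp_def)
      then have "(\<Sum>i<m. b (p i) v * b (q j) (q i) - b (q i) v * b (q j) (p i)) =
          (\<Sum>i<m. if i = j then b (q i) v else 0)"
        using pq that by (intro sum.cong refl) (auto simp: symp_def)
      then show ?thesis using that by (simp add: bxy)
    qed
    have xu: "b (p j) u = 0" "b (q j) u = 0" "b u (p j) = 0" "b u (q j) = 0" if "j < m" for j
      using that u[of "p j"] u[of "q j"] skew[of u] by auto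
    have uy: "b u y = b u v"
      unfolding bxy using xu by simp
    have self: "b x x = 0" for x using skew[of x x] by simp
    \<comment> \<open>The pair \<open>u\<close> and rescaled \<open>y\<close> would lengthen the
      family.\<close>
    have "symp (Suc m) (p(m := u)) (q(m := y /\<^sub>R b u v))"
      using pq xu py qy uy nz skew[of y "q _"]
      by (auto simp: symp_def less_Suc_eq self linear_cmul[OF l(1)] linear_cmul[OF l(2)])
    then show False using max by blast
  qed
  ultimately show ?thesis
    using m that[of ?S] by auto
qed

section \<open>Orthonormal frames\<close>

text \<open>Each functional \<open>f\<close> is the inner product with a vector \<open>r f\<close>.
  The common zeros contain the orthogonal complement of the span of these vectors, and this span has
  dimension at most \<open>card F\<close>.\<close>

lemma DIM_le_dim_zeros_plus_card:
  fixes F :: "('e::euclidean_space \<Rightarrow> real) set"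
  assumes "finite F" and lin: "\<And>f. f \<in> F \<Longrightarrow> linear f"
  shows "DIM('e) \<le> dim {u. \<forall>f\<in>F. f u = 0} + card F"
proof -
  define r where "r f = (\<Sum>i\<in>Basis. f i *\<^sub>R i)" for f :: "'e \<Rightarrow> real"
  have r: "r f \<bullet> u = f u" if "f \<in> F" for f u
  proof -
    have "f u = f (\<Sum>i\<in>Basis. (u \<bullet> i) *\<^sub>R i)" by (simp add: euclidean_representation)
    also have "\<dots> = (\<Sum>i\<in>Basis. (u \<bullet> i) * f i)"
      by (simp add: linear_sum[OF lin[OF that]] linear_cmul[OF lin[OF that]])
    finally show ?thesis by (simp add: r_def inner_sum_left inner_commute[of u] mult.commute)
  qed
  have "dim {y \<in> (UNIV::'e set). \<forall>x \<in> span (r ` F). real_inner_class.orthogonal x y} + dim (span (r ` F)) = DIM('e)"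
    using dim_subspace_orthogonal_to_vectors[of "span (r ` F)" "UNIV::'e set"] by simp
  moreover have "dim {y \<in> (UNIV::'e set). \<forall>x \<in> span (r ` F). real_inner_class.orthogonal x y} \<le> dim {u. \<forall>f\<in>F. f u = 0}"
    by (rule dim_subset) (auto simp: real_inner_class.orthogonal_def span_base simp flip: r)
  moreover have "dim (span (r ` F)) \<le> card F"
    using dim_le_card[of "span (r ` F)" "r ` F"] assms(1) card_image_le[OF assms(1), of r] by simp
  ultimately show ?thesis by linarith
qed

text \<open>Vectors orthonormal for \<open>g\<close> are independent, so \<open>DIM('e)\<close> of
  them span the space. The expansion holds on the frame itself, and the vectors satisfying it form a
  subspace.\<close>

lemma orthonormal_frame_expand:
  fixes g :: "'e::euclidean_space \<Rightarrow> 'e \<Rightarrow> real"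
  assumes g: "bilinear g" and E: "orthonormal_frame g E"
  shows "x = (\<Sum>i<DIM('e). g x (E ! i) *\<^sub>R E ! i)"
proof -
  let ?n = "DIM('e)"
  have len: "length E = ?n" and on: "\<And>i j. i < ?n \<Longrightarrow> j < ?n \<Longrightarrow> g (E ! i) (E ! j) = (if i = j then 1 else 0)"
    using E unfolding orthonormal_frame_def by auto
  have l: "linear (\<lambda>x. g x y)" for y
    using g by (auto simp: bilinear_def)
  have gE: "g (\<Sum>i<?n. c i *\<^sub>R E ! i) (E ! j) = c j" if "j < ?n" for c j
  proof -
    have "g (\<Sum>i<?n. c i *\<^sub>R E ! i) (E ! j) = (\<Sum>i<?n. if i = j then c i else 0)"
      unfolding linear_sum[OF l] linear_cmul[OF l] using on that by (intro sum.cong refl) simp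
    then show ?thesis using that by simp
  qed
  have inj: "inj_on ((!) E) {..<?n}"
  proof (rule inj_onI)
    fix i j assume "i \<in> {..<?n}" "j \<in> {..<?n}" "E ! i = E ! j"
    then show "i = j" using on[of i j] on[of j j] by (simp split: if_splits)
  qed
  have set: "set E = (!) E ` {..<?n}"
    using len by (simp add: set_conv_nth image_def lessThan_def) blast
  have "independent (set E)"
  proof (rule independent_if_scalars_zero)
    fix f x assume f: "(\<Sum>x\<in>set E. f x *\<^sub>R x) = 0" and x: "x \<in> set E"
    obtain j where j: "j < ?n" "x = E ! j" using x unfolding set by auto
    have "(\<Sum>i<?n. f (E ! i) *\<^sub>R E ! i) = 0"
      using f unfolding set by (simp add: sum.reindex[OF inj])
    then show "f x = 0"
      using gE[OF j(1), of "\<lambda>i. f (E ! i)"] j(2) linear_0[OF l] by simp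
  qed simp
  moreover have "card (set E) = ?n" unfolding set using inj by (simp add: card_image)
  ultimately have "UNIV \<subseteq> span (set E)"
    by (intro card_ge_dim_independent) auto
  moreover have "span (set E) \<subseteq> {x. x = (\<Sum>i<?n. g x (E ! i) *\<^sub>R E ! i)}"
  proof (rule span_minimal)
    show "set E \<subseteq> {x. x = (\<Sum>i<?n. g x (E ! i) *\<^sub>R E ! i)}"
    proof
      fix x assume "x \<in> set E"
      then obtain j where j: "j < ?n" "x = E ! j" unfolding set by auto
      have "(\<Sum>i<?n. g x (E ! i) *\<^sub>R E ! i) = (\<Sum>i<?n. if i = j then E ! i else 0)"
        using on j by (intro sum.cong refl) auto
      then show "x \<in> {x. x = (\<Sum>i<?n. g x (E ! i) *\<^sub>R E ! i)}" using j by simp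
    qed
    show "subspace {x. x = (\<Sum>i<?n. g x (E ! i) *\<^sub>R E ! i)}"
      unfolding subspace_def
    proof (intro conjI allI impI ballI CollectI)
      fix c x assume "x \<in> {x. x = (\<Sum>i<?n. g x (E ! i) *\<^sub>R E ! i)}"
      then have x: "(\<Sum>i<?n. g x (E ! i) *\<^sub>R E ! i) = x" by simp
      have "(\<Sum>i<?n. g (c *\<^sub>R x) (E ! i) *\<^sub>R E ! i) = c *\<^sub>R (\<Sum>i<?n. g x (E ! i) *\<^sub>R E ! i)"
        by (simp only: scaleR_sum_right linear_cmul[OF l] scaleR_scaleR real_scaleR_def)
      then show "c *\<^sub>R x = (\<Sum>i<?n. g (c *\<^sub>R x) (E ! i) *\<^sub>R E ! i)"
        unfolding x by (rule sym)
    qed (auto simp: linear_0[OF l] linear_add[OF l] scaleR_add_left sum.distrib)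
  qed
  ultimately show ?thesis by blast
qed

section \<open>Orthonormal pairs for a complex structure\<close>

text \<open>The use of \<open>sorted_wrt\<close> lets orthonormality unfold along
  \<open>Cons\<close> and append; for symmetric \<open>g\<close>, the version with indices is
  recovered by \<open>orthonormal_list_nth\<close>.\<close>

definition orthonormal_list :: "('e \<Rightarrow> 'e \<Rightarrow> real) \<Rightarrow> 'e list \<Rightarrow> bool" where
  "orthonormal_list g L \<longleftrightarrow> (\<forall>x\<in>set L. g x x = 1) \<and> sorted_wrt (\<lambda>x y. g x y = 0) L"

lemma orthonormal_list_nth:
  assumes sym: "\<And>x y. g x y = g y x" and "orthonormal_list g L" "i < length L" "j < length L"
  shows "g (L ! i) (L ! j) = (if i = j then 1 else 0)"
proof -
  have lt: "g (L ! i) (L ! j) = 0" if "i < j" "j < length L" for i j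
    using assms(2) that sorted_wrt_nth_less[of "\<lambda>x y. g x y = 0" L i j] by (simp add: orthonormal_list_def)
  show ?thesis
  proof (cases i j rule: linorder_cases)
    case less
    then show ?thesis using lt assms(4) by simp
  next
    case equal
    then show ?thesis using assms(2,3) by (simp add: orthonormal_list_def)
  next
    case greater
    then have "g (L ! j) (L ! i) = 0" using lt assms(3) by simp
    then show ?thesis unfolding sym[of "L ! i" "L ! j"] using greater by simp
  qed
qed

abbreviation pairs :: "('e \<Rightarrow> 'e) \<Rightarrow> 'e list \<Rightarrow> 'e list" where
  "pairs J Xs \<equiv> concat (map (\<lambda>X. [X, J X]) Xs)"

lemma length_pairs: "length (pairs J Xs) = 2 * length Xs"
  by (induction Xs) auto

lemma set_pairs: "set (pairs J Xs) = set Xs \<union> J ` set Xs"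
  by (induction Xs) auto

lemma nth_pairs:
  assumes "i < length Xs"
  shows "pairs J Xs ! (2 * i) = Xs ! i" "pairs J Xs ! (2 * i + 1) = J (Xs ! i)"
proof -
  have "pairs J Xs ! (2 * i) = Xs ! i \<and> pairs J Xs ! (2 * i + 1) = J (Xs ! i)"
    using assms
  proof (induction Xs arbitrary: i)
    case (Cons X Xs)
    then show ?case by (cases i) auto
  qed simp
  then show "pairs J Xs ! (2 * i) = Xs ! i" "pairs J Xs ! (2 * i + 1) = J (Xs ! i)" by auto
qed

text \<open>Gram-Schmidt in steps of two: while fewer than \<open>dim W\<close> vectors are chosen,
  some unit vector \<open>X\<close> of \<open>W\<close> is orthogonal to all of them. As
  \<open>J\<close> is skew for \<open>g\<close> on \<open>W\<close> and preserves the chosen vectors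
  up to sign, \<open>J X\<close> is orthogonal to them and to \<open>X\<close> too.\<close>

lemma unitary_pairs_exist:
  fixes g :: "'e::euclidean_space \<Rightarrow> 'e \<Rightarrow> real"
  assumes g: "bilinear g" and sym: "\<And>x y. g x y = g y x" and pos: "\<And>x. x \<noteq> 0 \<Longrightarrow> g x x > 0"
    and W: "subspace W"
    and J: "\<And>x. x \<in> W \<Longrightarrow> J x \<in> W" "\<And>x. x \<in> W \<Longrightarrow> J (J x) = - x"
      "\<And>x y. x \<in> W \<Longrightarrow> y \<in> W \<Longrightarrow> g (J x) (J y) = g x y"
    and "2 * m \<le> dim W"
  shows "\<exists>Xs. length Xs = m \<and> set Xs \<subseteq> W \<and> orthonormal_list g (pairs J Xs)"
  using assms(8)
proof (induction m)
  case 0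
  then show ?case by (simp add: orthonormal_list_def)
next
  case (Suc m)
  then obtain Xs where Xs: "length Xs = m" "set Xs \<subseteq> W" "orthonormal_list g (pairs J Xs)"
    by auto
  let ?L = "pairs J Xs"
  have l: "linear (g x)" "linear (\<lambda>x. g x y)" for x y
    using g by (auto simp: bilinear_def)
  have LW: "set ?L \<subseteq> W" using Xs(2) J(1) unfolding set_pairs by auto
  have on: "g x y = (if x = y then 1 else 0)" if "x \<in> set ?L" "y \<in> set ?L" for x y
  proof -
    obtain i where i: "i < length ?L" "?L ! i = x" using \<open>x \<in> _\<close> unfolding in_set_conv_nth by blast
    obtain j where j: "j < length ?L" "?L ! j = y" using \<open>y \<in> _\<close> unfolding in_set_conv_nth by blast
    have "g x x = 1" using Xs(3) that(1) unfolding orthonormal_list_def by blast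
    moreover have "g x y = (if i = j then 1 else 0)"
      using orthonormal_list_nth[of g ?L i j, OF sym Xs(3) i(1) j(1)] unfolding i(2) j(2) .
    ultimately show ?thesis using i(2) j(2) by (cases "x = y") auto
  qed
  have "\<not> W \<subseteq> span (set ?L)"
  proof
    assume "W \<subseteq> span (set ?L)"
    then have "dim W \<le> card (set ?L)" by (rule dim_le_card) simp
    also have "\<dots> \<le> 2 * m" using card_length[of ?L] length_pairs[of J Xs] Xs(1) by simp
    finally show False using Suc.prems by simp
  qed
  then obtain w where w: "w \<in> W" "w \<notin> span (set ?L)" by blast
  define z where "z = w - (\<Sum>y\<in>set ?L. g w y *\<^sub>R y)"
  have zW: "z \<in> W"
    unfolding z_def using LW w(1) W by (intro subspace_diff subspace_sum subspace_scale) auto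
  have "z \<noteq> 0"
  proof
    assume "z = 0"
    then have "w = (\<Sum>y\<in>set ?L. g w y *\<^sub>R y)" by (simp add: z_def)
    then have "w \<in> span (set ?L)" by (metis (no_types, lifting) span_sum span_scale span_base)
    then show False using w(2) by simp
  qed
  then have gz: "g z z > 0" by (rule pos)
  have zL: "g z x = 0" if "x \<in> set ?L" for x
  proof -
    have "(\<Sum>y\<in>set ?L. g w y * g y x) = (\<Sum>y\<in>set ?L. if y = x then g w y else 0)"
      using on that by (intro sum.cong refl) simp
    then show ?thesis
      unfolding z_def using that by (simp add: linear_diff[OF l(2)] linear_sum[OF l(2)] linear_cmul[OF l(2)])
  qed
  define X where "X = z /\<^sub>R sqrt (g z z)"
  have XW: "X \<in> W" unfolding X_def using zW W by (intro subspace_scale)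
  have XX: "g X X = 1"
    using gz by (simp add: X_def linear_cmul[OF l(1)] linear_cmul[OF l(2)] field_simps)
  have XL: "g X x = 0" if "x \<in> set ?L" for x
    using zL[OF that] by (simp add: X_def linear_cmul[OF l(2)])
  \<comment> \<open>The isometry property applied to \<open>x\<close> and \<open>J y\<close>,
    together with \<open>J (J y) = - y\<close>.\<close>
  have skew: "g (J x) y = - g x (J y)" if "x \<in> W" "y \<in> W" for x y
    using J(2)[OF that(2)] J(3)[OF that(1) J(1)[OF that(2)]] linear_neg[OF l(1), of "J x" y] by simp
  have "g (J X) y = 0" if "y \<in> set ?L" for y
  proof -
    have "J y \<in> set ?L \<or> - J y \<in> set ?L"
      using that J(2) Xs(2) unfolding set_pairs by auto
    then have "g X (J y) = 0"
      using XL[of "J y"] XL[of "- J y"] linear_neg[OF l(1), of X "J y"] by auto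
    then show ?thesis using skew[OF XW, of y] LW that by auto
  qed
  moreover have "g X (J X) = 0"
    using skew[OF XW XW] sym[of X "J X"] by linarith
  moreover have "g (J X) (J X) = 1" using J(3)[OF XW XW] XX by simp
  ultimately have "orthonormal_list g (pairs J (X # Xs))"
    using Xs(3) XX XL by (auto simp: orthonormal_list_def)
  then show ?case
    using Xs XW by (intro exI[of _ "X # Xs"]) simp
qed

text \<open>Here \<open>\<beta>\<close> is \<open>g\<close> composed with \<open>J\<close> on the
  pairs and vanishes on the first \<open>N\<close> vectors. A vector \<open>x\<close> and its
  partner \<open>J x\<close> give \<open>g x (J (J x)) = - g x x = - 1\<close>, so
  \<open>alt_sum_pairs\<close> applies with \<open>c = - 1\<close>.\<close>

lemma alt_sum_unitary_pairs:
  fixes \<beta> :: "'e::real_vector \<Rightarrow> 'e \<Rightarrow> real"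
  assumes F: "depends_below N F" and skew: "\<And>x y. \<beta> x y = - \<beta> y x" and g: "bilinear g"
    and on: "\<And>i j. i < N + 2 * m \<Longrightarrow> j < N + 2 * m \<Longrightarrow> g (v i) (v j) = (if i = j then 1 else 0)"
    and J: "\<And>l. l < m \<Longrightarrow> J (v (N + 2 * l)) = v (N + 2 * l + 1)"
      "\<And>l. l < m \<Longrightarrow> J (v (N + 2 * l + 1)) = - v (N + 2 * l)"
    and \<beta>: "\<And>i j. i < N + 2 * m \<Longrightarrow> j < N + 2 * m \<Longrightarrow>
      \<beta> (v i) (v j) = (if N \<le> i \<and> N \<le> j then g (v i) (J (v j)) else 0)"
  shows "alt_sum (N + 2 * m) (\<lambda>w. F w * (\<Prod>i<m. \<beta> (w (N + 2 * i)) (w (N + 2 * i + 1)))) v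
    = (- 2) ^ m * fact m * alt_sum N F v"
proof -
  have neg: "g x (- y) = - g x y" for x y
    using g linear_neg[of "g x" y] by (simp add: bilinear_def)
  have "alt_sum (N + 2 * m) (\<lambda>w. F w * (\<Prod>i<m. \<beta> (w (N + 2 * i)) (w (N + 2 * i + 1)))) v
    = 2 ^ m * fact m * (- 1) ^ m * alt_sum N F v"
  proof (rule alt_sum_pairs[OF F skew])
    fix i j assume ij: "i < N + 2 * m" "j < N + 2 * m" and nz: "\<beta> (v i) (v j) \<noteq> 0"
    then have N: "N \<le> i" "N \<le> j" and nz': "g (v i) (J (v j)) \<noteq> 0"
      using \<beta>[of i j] by (auto split: if_splits)
    define l where "l = (j - N) div 2"
    have l: "l < m" "j = N + 2 * l \<or> j = N + 2 * l + 1" using N(2) ij(2) by (auto simp: l_def)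
    from l(2) have "j = N + 2 * l \<and> i = N + 2 * l + 1 \<or> j = N + 2 * l + 1 \<and> i = N + 2 * l"
    proof
      assume j: "j = N + 2 * l"
      then have "g (v i) (v (N + 2 * l + 1)) \<noteq> 0" using nz' J(1)[OF l(1)] by simp
      then show ?thesis using on[of i "N + 2 * l + 1"] ij(1) l(1) j by (auto split: if_splits)
    next
      assume j: "j = N + 2 * l + 1"
      then have "g (v i) (v (N + 2 * l)) \<noteq> 0" using nz' J(2)[OF l(1)] neg by simp
      then show ?thesis using on[of i "N + 2 * l"] ij(1) l(1) j by (auto split: if_splits)
    qed
    then show "\<exists>l<m. i = N + 2 * l \<and> j = N + 2 * l + 1 \<or> i = N + 2 * l + 1 \<and> j = N + 2 * l"
      using l(1) by blast
  next
    fix l assume l: "l < m"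
    have "\<beta> (v (N + 2 * l)) (v (N + 2 * l + 1)) = - g (v (N + 2 * l)) (v (N + 2 * l))"
      using \<beta>[of "N + 2 * l" "N + 2 * l + 1"] J(2)[OF l] l neg by simp
    then show "\<beta> (v (N + 2 * l)) (v (N + 2 * l + 1)) = - 1"
      using on[of "N + 2 * l" "N + 2 * l"] l by simp
  qed
  then show ?thesis
    by (simp add: mult_ac flip: power_mult_distrib)
qed

section \<open>Comparison of orthonormal frames\<close>

text \<open>Applying \<open>\<theta> j\<close> to the orthonormal expansion identifies it with
  \<open>g\<close> paired with \<open>F ! j\<close>.\<close>

lemma dual_coframe_expand:
  fixes g :: "'e::euclidean_space \<Rightarrow> 'e \<Rightarrow> real"
  assumes g: "bilinear g" and F: "orthonormal_frame g F" and \<theta>: "dual_coframe F \<theta>"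
  shows "x = (\<Sum>i<DIM('e). \<theta> i x *\<^sub>R F ! i)"
proof -
  let ?n = "DIM('e)"
  have "\<theta> j x = g x (F ! j)" if "j < ?n" for j
  proof -
    have lin: "linear (\<theta> j)" and \<theta>F: "\<theta> j (F ! i) = (if j = i then 1 else 0)" if "i < ?n" for i
      using \<theta> F that \<open>j < ?n\<close> by (auto simp: dual_coframe_def orthonormal_frame_def)
    have "\<theta> j x = \<theta> j (\<Sum>i<?n. g x (F ! i) *\<^sub>R F ! i)"
      using orthonormal_frame_expand[OF g F] by simp
    also have "\<dots> = (\<Sum>i<?n. if i = j then g x (F ! i) else 0)"
      unfolding linear_sum[OF lin[OF that]] linear_cmul[OF lin[OF that]] by (intro sum.cong refl) (simp add: \<theta>F)
    finally show ?thesis using that by simp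
  qed
  then show ?thesis using orthonormal_frame_expand[OF g F, of x] by simp
qed

lemma same_orientation_refl: "same_orientation E E"
proof -
  have "E ! j = (\<Sum>i<length E. 1\<^sub>m (length E) $$ (i, j) *\<^sub>R E ! i)" if "j < length E" for j
  proof -
    have "(\<Sum>i<length E. 1\<^sub>m (length E) $$ (i, j) *\<^sub>R E ! i) = (\<Sum>i<length E. if i = j then E ! i else 0)"
      using that by (intro sum.cong refl) auto
    then show ?thesis using that by simp
  qed
  then show ?thesis
    unfolding same_orientation_def by (intro conjI refl bexI[of _ "1\<^sub>m (length E)"]) auto
qed

text \<open>By the Leibniz formula the sum is the determinant of the transition matrix
  \<open>B\<close>. Both frames being orthonormal, \<open>B\<close> is an orthogonal matrix, so its
  determinant squares to one; equal orientation makes it positive.\<close>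

lemma alt_sum_same_orientation:
  fixes g :: "'e::euclidean_space \<Rightarrow> 'e \<Rightarrow> real"
  assumes g: "bilinear g" and E: "orthonormal_frame g E" and F: "orthonormal_frame g F"
    and EF: "same_orientation E F"
  shows "alt_sum DIM('e) (\<lambda>w. \<Prod>i<DIM('e). g (w i) (E ! i)) ((!) F) = 1"
proof -
  let ?n = "DIM('e)"
  have on: "g (G ! i) (G ! j) = (if i = j then 1 else 0)"
    if "orthonormal_frame g G" "i < ?n" "j < ?n" for G i j
    using that by (simp add: orthonormal_frame_def)
  have lin: "linear (g x)" "linear (\<lambda>x. g x y)" for x y
    using g by (auto simp: bilinear_def)
  obtain B where B: "B \<in> carrier_mat ?n ?n" "Determinant.det B > 0"
    and FB: "\<And>j. j < ?n \<Longrightarrow> F ! j = (\<Sum>i<?n. B $$ (i, j) *\<^sub>R E ! i)"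
    using EF E unfolding same_orientation_def orthonormal_frame_def by auto
  have gB: "g (F ! j) (E ! i) = B $$ (i, j)" if "i < ?n" "j < ?n" for i j
  proof -
    have "g (F ! j) (E ! i) = (\<Sum>l<?n. if l = i then B $$ (l, j) else 0)"
      unfolding FB[OF that(2)] linear_sum[OF lin(2)] linear_cmul[OF lin(2)]
      using on[OF E] that by (intro sum.cong refl) auto
    then show ?thesis using that by simp
  qed
  have "B\<^sup>T * B = 1\<^sub>m ?n"
  proof (rule eq_matI)
    fix i j assume "i < dim_row (1\<^sub>m ?n)" "j < dim_col (1\<^sub>m ?n)"
    then have ij: "i < ?n" "j < ?n" by auto
    have "(B\<^sup>T * B) $$ (i, j) = (\<Sum>l<?n. B $$ (l, i) * B $$ (l, j))"
      using B(1) ij by (simp add: scalar_prod_def atLeast0LessThan)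
    also have "\<dots> = (\<Sum>l<?n. B $$ (l, j) * g (F ! i) (E ! l))"
      using ij by (intro sum.cong refl) (simp add: gB)
    also have "\<dots> = g (F ! i) (F ! j)"
      unfolding FB[OF ij(2)] linear_sum[OF lin(1)] linear_cmul[OF lin(1)] by simp
    finally show "(B\<^sup>T * B) $$ (i, j) = 1\<^sub>m ?n $$ (i, j)"
      using on[OF F] ij by simp
  qed (use B(1) in auto)
  then have "Determinant.det B * Determinant.det B = 1"
    using B(1) by (metis Determinant.det_mult Determinant.det_transpose det_one transpose_carrier_mat)
  then have "Determinant.det B = 1"
    using B(2) by (metis abs_of_pos abs_square_eq_1 power2_eq_square)
  moreover have "alt_sum ?n (\<lambda>w. \<Prod>i<?n. g (w i) (E ! i)) ((!) F) = Determinant.det B"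
    unfolding alt_sum_def Determinant.det_def'[OF B(1)] atLeast0LessThan
  proof (intro sum.cong refl)
    fix \<sigma> assume "\<sigma> \<in> {\<sigma>. \<sigma> permutes {..<?n}}"
    then have "\<sigma> i < ?n" if "i < ?n" for i using that permutes_in_image[of \<sigma> "{..<?n}" i] by simp
    then have "(\<Prod>i<?n. g (F ! \<sigma> i) (E ! i)) = (\<Prod>i<?n. B $$ (i, \<sigma> i))"
      by (intro prod.cong refl) (simp add: gB)
    then show "of_int (sign \<sigma>) * (\<Prod>i<?n. g (F ! \<sigma> i) (E ! i)) = of_int (sign \<sigma>) * (\<Prod>i<?n. B $$ (i, \<sigma> i))"
      by simp
  qed
  ultimately show ?thesis by simp
qed

section \<open>Metric contact pairs on a vector space\<close>

text \<open>The situation in one tangent space, with \<open>b\<^sub>1\<close> and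
  \<open>b\<^sub>2\<close> for the values of the exterior derivatives, of which only bilinearity,
  skewness and the stated algebraic conditions enter.\<close>

locale metric_contact_space =
  fixes h k :: nat and a\<^sub>1 a\<^sub>2 :: "'e::euclidean_space \<Rightarrow> real" and b\<^sub>1 b\<^sub>2 :: "'e \<Rightarrow> 'e \<Rightarrow> real"
    and Z\<^sub>1 Z\<^sub>2 :: 'e and J :: "'e \<Rightarrow> 'e" and g :: "'e \<Rightarrow> 'e \<Rightarrow> real"
  assumes DIM: "DIM('e) = 2 * h + 2 * k + 2"
    and lin_a: "linear a\<^sub>1" "linear a\<^sub>2"
    and bil_b: "bilinear b\<^sub>1" "bilinear b\<^sub>2"
    and skew: "\<And>u v. b\<^sub>1 u v = - b\<^sub>1 v u" "\<And>u v. b\<^sub>2 u v = - b\<^sub>2 v u"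
    and power: "wedge_power2 (form2 b\<^sub>1) (h + 1) = (\<lambda>v. 0)" "wedge_power2 (form2 b\<^sub>2) (k + 1) = (\<lambda>v. 0)"
    and reeb_a: "a\<^sub>1 Z\<^sub>1 = 1" "a\<^sub>2 Z\<^sub>2 = 1" "a\<^sub>1 Z\<^sub>2 = 0" "a\<^sub>2 Z\<^sub>1 = 0"
    and reeb_b: "\<And>v. b\<^sub>1 Z\<^sub>1 v = 0" "\<And>v. b\<^sub>2 Z\<^sub>1 v = 0" "\<And>v. b\<^sub>1 Z\<^sub>2 v = 0" "\<And>v. b\<^sub>2 Z\<^sub>2 v = 0"
    and JJ: "\<And>u. J (J u) = - u + a\<^sub>1 u *\<^sub>R Z\<^sub>1 + a\<^sub>2 u *\<^sub>R Z\<^sub>2"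
    and bil_g: "bilinear g" and sym_g: "\<And>u v. g u v = g v u" and pos_g: "\<And>u. u \<noteq> 0 \<Longrightarrow> g u u > 0"
    and gJ: "\<And>u v. g u (J v) = b\<^sub>1 u v + b\<^sub>2 u v"
    and gZ: "\<And>u. g u Z\<^sub>1 = a\<^sub>1 u" "\<And>u. g u Z\<^sub>2 = a\<^sub>2 u"
    and J_T: "J ` ({u. a\<^sub>1 u = 0} \<inter> {u. \<forall>v. b\<^sub>1 u v = 0}) \<subseteq> {u. a\<^sub>1 u = 0} \<inter> {u. \<forall>v. b\<^sub>1 u v = 0}"
      "J ` ({u. a\<^sub>2 u = 0} \<inter> {u. \<forall>v. b\<^sub>2 u v = 0}) \<subseteq> {u. a\<^sub>2 u = 0} \<inter> {u. \<forall>v. b\<^sub>2 u v = 0}"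
begin

text \<open>The axioms are symmetric under exchanging the two forms, so what is proved for
  \<open>K\<^sub>1\<close> carries over to \<open>K\<^sub>2\<close>.\<close>

lemma swapped: "metric_contact_space k h a\<^sub>2 a\<^sub>1 b\<^sub>2 b\<^sub>1 Z\<^sub>2 Z\<^sub>1 J g"
  by (rule metric_contact_space.intro)
    (assumption | rule lin_a bil_b skew power reeb_a reeb_b bil_g sym_g pos_g gZ J_T
      | simp add: DIM JJ gJ)+

text \<open>\<open>T\<^sub>1\<close> and \<open>T\<^sub>2\<close> play the role of the characteristic distributions \<open>T\<F>\<^sub>1\<close> and \<open>T\<F>\<^sub>2\<close>, and
  \<open>K\<^sub>1\<close>, \<open>K\<^sub>2\<close> of their subspaces orthogonal to both Reeb vectors.\<close>

definition T\<^sub>1 where "T\<^sub>1 = {u. a\<^sub>1 u = 0} \<inter> {u. \<forall>v. b\<^sub>1 u v = 0}"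
definition T\<^sub>2 where "T\<^sub>2 = {u. a\<^sub>2 u = 0} \<inter> {u. \<forall>v. b\<^sub>2 u v = 0}"

definition K\<^sub>1 where "K\<^sub>1 = {u. a\<^sub>1 u = 0 \<and> a\<^sub>2 u = 0 \<and> (\<forall>v. b\<^sub>1 u v = 0)}"
definition K\<^sub>2 where "K\<^sub>2 = {u. a\<^sub>2 u = 0 \<and> a\<^sub>1 u = 0 \<and> (\<forall>v. b\<^sub>2 u v = 0)}"

lemma K\<^sub>1_subset: "K\<^sub>1 \<subseteq> T\<^sub>1"
  by (auto simp: K\<^sub>1_def T\<^sub>1_def)

text \<open>Decomposability keeps \<open>J u\<close> in \<open>T\<^sub>1\<close>. Moreover
  \<open>a\<^sub>2 (J u)\<close> equals \<open>g Z\<^sub>2 (J u)\<close>, which vanishes because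
  \<open>Z\<^sub>2\<close> lies in the kernels of \<open>b\<^sub>1\<close> and
  \<open>b\<^sub>2\<close>.\<close>

lemma J_K\<^sub>1:
  assumes "u \<in> K\<^sub>1"
  shows "J u \<in> K\<^sub>1"
proof -
  have "J u \<in> T\<^sub>1" using J_T(1) assms K\<^sub>1_subset unfolding T\<^sub>1_def by blast
  moreover have "a\<^sub>2 (J u) = 0"
    using gJ[of Z\<^sub>2 u] gZ(2)[of "J u"] sym_g[of Z\<^sub>2 "J u"] reeb_b by simp
  ultimately show ?thesis by (simp add: K\<^sub>1_def T\<^sub>1_def)
qed

lemma JJ_ker: "a\<^sub>1 u = 0 \<Longrightarrow> a\<^sub>2 u = 0 \<Longrightarrow> J (J u) = - u"
  by (simp add: JJ)

text \<open>The conditions \<open>a\<^sub>1 u = 0\<close>, \<open>a\<^sub>2 u = 0\<close> and the at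
  most \<open>2 * h\<close> equations from \<open>skew_form_kernel\<close> force \<open>u\<close>
  into \<open>K\<^sub>1\<close>, and the whole space has dimension
  \<open>2 * h + 2 * k + 2\<close>.\<close>

lemma dim_K\<^sub>1: "2 * k \<le> dim K\<^sub>1"
proof -
  obtain S where S: "finite S" "card S \<le> 2 * h" "\<And>u v. (\<And>s. s \<in> S \<Longrightarrow> b\<^sub>1 s u = 0) \<Longrightarrow> b\<^sub>1 u v = 0"
    using skew_form_kernel[of b\<^sub>1 h, OF bil_b(1) skew(1)] power(1) by auto
  let ?F = "{a\<^sub>1, a\<^sub>2} \<union> b\<^sub>1 ` S"
  have "card ?F \<le> card {a\<^sub>1, a\<^sub>2} + card (b\<^sub>1 ` S)" by (rule card_Un_le)
  also have "\<dots> \<le> 2 + 2 * h"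
    using card_image_le[OF S(1), of b\<^sub>1] S(2) card_insert_le_m1[of 2 "{a\<^sub>2}" a\<^sub>1] by simp
  finally have "card ?F \<le> 2 + 2 * h" .
  moreover have "DIM('e) \<le> dim {u. \<forall>f\<in>?F. f u = 0} + card ?F"
    by (rule DIM_le_dim_zeros_plus_card) (use S(1) lin_a bil_b in \<open>auto simp: bilinear_def\<close>)
  moreover have "dim {u. \<forall>f\<in>?F. f u = 0} \<le> dim K\<^sub>1"
    by (rule dim_subset) (auto simp: K\<^sub>1_def intro: S(3))
  ultimately show ?thesis using DIM by linarith
qed

text \<open>On \<open>K\<^sub>1\<close> the square of \<open>J\<close> is minus the identity, and
  \<open>J\<close> is an isometry there because \<open>g u (J v)\<close> is skew in \<open>u\<close>
  and \<open>v\<close>.\<close>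

lemma unitary_pairs_K\<^sub>1: "\<exists>Ys. length Ys = k \<and> set Ys \<subseteq> K\<^sub>1 \<and> orthonormal_list g (pairs J Ys)"
proof (rule unitary_pairs_exist[OF bil_g sym_g pos_g])
  show "subspace K\<^sub>1"
    using lin_a unfolding K\<^sub>1_def subspace_def
    by (auto simp: linear_0 linear_add linear_cmul bilinear_lzero[OF bil_b(1)] bilinear_ladd[OF bil_b(1)]
        bilinear_lmul[OF bil_b(1)])
  show "J x \<in> K\<^sub>1" if "x \<in> K\<^sub>1" for x by (rule J_K\<^sub>1[OF that])
  show JJx: "J (J x) = - x" if "x \<in> K\<^sub>1" for x using that by (simp add: K\<^sub>1_def JJ_ker)
  show "g (J x) (J y) = g x y" if "x \<in> K\<^sub>1" "y \<in> K\<^sub>1" for x y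
  proof -
    have "g (J x) (J y) = - (b\<^sub>1 y (J x) + b\<^sub>2 y (J x))"
      unfolding gJ using skew(1)[of "J x" y] skew(2)[of "J x" y] by simp
    also have "\<dots> = - g y (J (J x))" by (simp only: gJ)
    also have "\<dots> = g y x"
      using JJx[OF that(1)] linear_neg[of "g y" x] bil_g by (simp add: bilinear_def)
    finally show ?thesis using sym_g[of x y] by linarith
  qed
  show "2 * k \<le> dim K\<^sub>1" by (rule dim_K\<^sub>1)
qed

lemma K\<^sub>2_eq: "K\<^sub>2 = metric_contact_space.K\<^sub>1 a\<^sub>2 a\<^sub>1 b\<^sub>2"
  using metric_contact_space.K\<^sub>1_def[OF swapped] by (simp add: K\<^sub>2_def)

lemma K\<^sub>2_subset: "K\<^sub>2 \<subseteq> T\<^sub>2"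
  by (auto simp: K\<^sub>2_def T\<^sub>2_def)

lemma J_K\<^sub>2: "u \<in> K\<^sub>2 \<Longrightarrow> J u \<in> K\<^sub>2"
  unfolding K\<^sub>2_eq by (rule metric_contact_space.J_K\<^sub>1[OF swapped])

lemma unitary_pairs_K\<^sub>2: "\<exists>Xs. length Xs = h \<and> set Xs \<subseteq> K\<^sub>2 \<and> orthonormal_list g (pairs J Xs)"
  unfolding K\<^sub>2_eq by (rule metric_contact_space.unitary_pairs_K\<^sub>1[OF swapped])

text \<open>Write \<open>y\<close> as \<open>- J (J y)\<close>. Then \<open>g x (J (J y))\<close>
  splits into a \<open>b\<^sub>1\<close> term, zero since \<open>J y\<close> is in
  \<open>K\<^sub>1\<close>, and a \<open>b\<^sub>2\<close> term, zero since \<open>x\<close> is in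
  \<open>K\<^sub>2\<close>.\<close>

lemma K\<^sub>2_orthogonal_K\<^sub>1:
  assumes "x \<in> K\<^sub>2" "y \<in> K\<^sub>1"
  shows "g x y = 0"
proof -
  have "g x (J (J y)) = b\<^sub>1 x (J y) + b\<^sub>2 x (J y)" by (rule gJ)
  also have "\<dots> = 0"
    using assms(1) J_K\<^sub>1[OF assms(2)] skew(1)[of x "J y"] by (simp add: K\<^sub>1_def K\<^sub>2_def)
  finally show ?thesis
    using assms(2) linear_neg[of "g x" y] bil_g by (simp add: K\<^sub>1_def JJ_ker bilinear_def)
qed

definition phi_frame :: "'e list \<Rightarrow> bool" where
  "phi_frame E \<longleftrightarrow> orthonormal_frame g E \<and>
     (\<exists>Xs Ys. length Xs = h \<and> length Ys = k \<and> E = Z\<^sub>1 # pairs J Xs @ Z\<^sub>2 # pairs J Ys \<and>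
        {Z\<^sub>1} \<union> set Xs \<union> J ` set Xs \<subseteq> T\<^sub>2 \<and> {Z\<^sub>2} \<union> set Ys \<union> J ` set Ys \<subseteq> T\<^sub>1)"

text \<open>The pairs found in \<open>K\<^sub>2\<close> and \<open>K\<^sub>1\<close> are joined with
  the Reeb vectors, whose products with them are values of \<open>a\<^sub>1\<close> and
  \<open>a\<^sub>2\<close>, hence zero.\<close>

lemma phi_frame_exists: "\<exists>E. phi_frame E"
proof -
  obtain Xs where Xs: "length Xs = h" "set Xs \<subseteq> K\<^sub>2" "orthonormal_list g (pairs J Xs)"
    using unitary_pairs_K\<^sub>2 by blast
  obtain Ys where Ys: "length Ys = k" "set Ys \<subseteq> K\<^sub>1" "orthonormal_list g (pairs J Ys)"
    using unitary_pairs_K\<^sub>1 by blast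
  let ?X = "pairs J Xs" and ?Y = "pairs J Ys"
  let ?E = "Z\<^sub>1 # ?X @ Z\<^sub>2 # ?Y"
  have X: "set ?X \<subseteq> K\<^sub>2" and Y: "set ?Y \<subseteq> K\<^sub>1"
    using Xs(2) Ys(2) J_K\<^sub>2 J_K\<^sub>1 unfolding set_pairs by auto
  have Z: "g Z\<^sub>1 x = a\<^sub>1 x" "g Z\<^sub>2 x = a\<^sub>2 x" for x
    using sym_g[of Z\<^sub>1 x] sym_g[of Z\<^sub>2 x] gZ by auto
  have "g x y = 0" if "x \<in> set ?X" "y \<in> set ?Y" for x y
    using K\<^sub>2_orthogonal_K\<^sub>1 X Y that by blast
  moreover have "a\<^sub>1 x = 0" "a\<^sub>2 x = 0" if "x \<in> set ?X \<union> set ?Y" for x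
    using X Y that unfolding K\<^sub>1_def K\<^sub>2_def by blast+
  ultimately have "orthonormal_list g ?E"
    using Xs(3) Ys(3) reeb_a
    unfolding orthonormal_list_def list.set set_append sorted_wrt.simps sorted_wrt_append
    by (auto simp: Z gZ simp del: set_concat)
  moreover have "length ?E = DIM('e)"
    using Xs(1) Ys(1) DIM length_pairs[of J Xs] length_pairs[of J Ys] by simp
  ultimately have "orthonormal_frame g ?E"
    using orthonormal_list_nth[of g ?E, OF sym_g] unfolding orthonormal_frame_def by blast
  moreover have "set Xs \<union> J ` set Xs \<subseteq> T\<^sub>2" "set Ys \<union> J ` set Ys \<subseteq> T\<^sub>1"
    using X Y K\<^sub>1_subset K\<^sub>2_subset unfolding set_pairs by blast+
  moreover have "Z\<^sub>1 \<in> T\<^sub>2" "Z\<^sub>2 \<in> T\<^sub>1"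
    using reeb_a reeb_b by (auto simp: T\<^sub>1_def T\<^sub>2_def)
  ultimately show ?thesis
    unfolding phi_frame_def using Xs(1) Ys(1) by (intro exI[of _ ?E] conjI exI[of _ Xs] exI[of _ Ys]) auto
qed

text \<open>The tensor is consumed from its last slot: the \<open>b\<^sub>2\<close> block gives
  \<open>(- 2) ^ k * fact k\<close>, the slot of \<open>a\<^sub>2\<close> must hold
  \<open>Z\<^sub>2\<close>, the \<open>b\<^sub>1\<close> block gives
  \<open>(- 2) ^ h * fact h\<close>, and \<open>a\<^sub>1\<close> is left with
  \<open>Z\<^sub>1\<close>.\<close>

lemma alt_sum_contact_tensor_phi_frame:
  assumes "phi_frame E"
  shows "alt_sum (2 * h + 2 * k + 2) (contact_tensor h k a\<^sub>1 b\<^sub>1 a\<^sub>2 b\<^sub>2) ((!) E) =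
    (- 1) ^ (h + k) * (2 ^ (h + k) * fact h * fact k)"
proof -
  let ?n = "2 * h + 2 * k + 2"
  obtain Xs Ys where len: "length Xs = h" "length Ys = k" and E: "E = Z\<^sub>1 # pairs J Xs @ Z\<^sub>2 # pairs J Ys"
    and X: "{Z\<^sub>1} \<union> set Xs \<union> J ` set Xs \<subseteq> T\<^sub>2" and Y: "{Z\<^sub>2} \<union> set Ys \<union> J ` set Ys \<subseteq> T\<^sub>1"
    and onE: "orthonormal_frame g E"
    using assms unfolding phi_frame_def by auto
  define v where "v = (!) E"
  have on: "g (v i) (v j) = (if i = j then 1 else 0)" if "i < ?n" "j < ?n" for i j
    using onE that DIM unfolding orthonormal_frame_def v_def by simp
  have vX: "v (1 + j) = pairs J Xs ! j" if "j < 2 * h" for j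
    using that len by (auto simp: v_def E nth_append length_pairs)
  have v0: "v 0 = Z\<^sub>1" by (simp add: v_def E)
  have vZ: "v (2 * h + 1) = Z\<^sub>2"
    using len by (simp add: v_def E nth_append length_pairs)
  have vY: "v (2 * h + 2 + j) = pairs J Ys ! j" for j
    using len by (simp add: v_def E nth_append length_pairs)
  have T2: "v i \<in> T\<^sub>2" if "i < 2 * h + 1" for i
  proof (cases i)
    case 0
    then show ?thesis using X v0 by simp
  next
    case (Suc j)
    then have "v i \<in> set (pairs J Xs)" using vX[of j] that len length_pairs[of J Xs] by (simp del: set_concat)
    then show ?thesis using X unfolding set_pairs by auto
  qed
  have T1: "v i \<in> T\<^sub>1" if "2 * h + 1 \<le> i" "i < ?n" for i
  proof (cases "i = 2 * h + 1")
    case True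
    then show ?thesis using Y vZ by simp
  next
    case False
    then have i: "2 * h + 2 + (i - (2 * h + 2)) = i" "i - (2 * h + 2) < length (pairs J Ys)"
      using that len by (auto simp: length_pairs)
    have "v i \<in> set (pairs J Ys)"
      using vY[of "i - (2 * h + 2)"] nth_mem[OF i(2)] unfolding i(1) by simp
    then show ?thesis using Y unfolding set_pairs by auto
  qed
  have a1: "a\<^sub>1 (v i) = 0" if "0 < i" "i < ?n" for i
    using on[of i 0] that gZ(1)[of "v i"] v0 by simp
  have a2: "a\<^sub>2 (v i) = 0" if "i \<noteq> 2 * h + 1" "i < ?n" for i
    using on[of i "2 * h + 1"] that gZ(2)[of "v i"] vZ by simp
  let ?F = "\<lambda>w. a\<^sub>1 (w 0) * (\<Prod>i<h. b\<^sub>1 (w (1 + 2 * i)) (w (1 + 2 * i + 1))) * a\<^sub>2 (w (2 * h + 1))"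
  let ?G = "\<lambda>w. a\<^sub>1 (w 0) * (\<Prod>i<h. b\<^sub>1 (w (1 + 2 * i)) (w (1 + 2 * i + 1)))"
  have "alt_sum ?n (contact_tensor h k a\<^sub>1 b\<^sub>1 a\<^sub>2 b\<^sub>2) v = alt_sum (2 * h + 2 + 2 * k)
      (\<lambda>w. ?F w * (\<Prod>i<k. b\<^sub>2 (w (2 * h + 2 + 2 * i)) (w (2 * h + 2 + 2 * i + 1)))) v"
    unfolding contact_tensor_def by (simp only: add_ac)
  \<comment> \<open>The first \<open>2 * h + 2\<close> vectors are in the kernel of
    \<open>b\<^sub>2\<close>. The later ones are in the kernel of \<open>b\<^sub>1\<close>, so there
    \<open>b\<^sub>2\<close> coincides with \<open>g\<close> composed with \<open>J\<close>.\<close>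
  also have "\<dots> = (- 2) ^ k * fact k * alt_sum (2 * h + 2) ?F v"
  proof (rule alt_sum_unitary_pairs[OF _ skew(2) bil_g])
    show "depends_below (2 * h + 2) ?F"
      by (auto simp: depends_below_def intro!: arg_cong2[where f = "(*)"] prod.cong)
    show "g (v i) (v j) = (if i = j then 1 else 0)" if "i < 2 * h + 2 + 2 * k" "j < 2 * h + 2 + 2 * k" for i j
      using on that by simp
    fix l assume l: "l < k"
    have y: "v (2 * h + 2 + 2 * l) = Ys ! l" "v (2 * h + 2 + 2 * l + 1) = J (Ys ! l)"
      using vY[of "2 * l"] vY[of "2 * l + 1"] nth_pairs[of l Ys J] l len by (simp_all only: add.assoc)
    then show "J (v (2 * h + 2 + 2 * l)) = v (2 * h + 2 + 2 * l + 1)" by simp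
    show "J (v (2 * h + 2 + 2 * l + 1)) = - v (2 * h + 2 + 2 * l)"
      unfolding y(2) unfolding y(1)[symmetric] by (rule JJ_ker) (use a1 a2 l in auto)
  next
    fix i j assume ij: "i < 2 * h + 2 + 2 * k" "j < 2 * h + 2 + 2 * k"
    have 0: "b\<^sub>2 (v l) u = 0" if "l < 2 * h + 2" for l u
      using T2[of l] that vZ reeb_b(4) by (cases "l = 2 * h + 1") (auto simp: T\<^sub>2_def)
    have "b\<^sub>1 (v l) u = 0" if "2 * h + 2 \<le> l" "l < ?n" for l u
      using T1[of l] that by (auto simp: T\<^sub>1_def)
    then show "b\<^sub>2 (v i) (v j) = (if 2 * h + 2 \<le> i \<and> 2 * h + 2 \<le> j then g (v i) (J (v j)) else 0)"
      using 0[of i "v j"] 0[of j "v i"] skew(2)[of "v i" "v j"] ij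
      by (cases "2 * h + 2 \<le> i"; cases "2 * h + 2 \<le> j") (simp_all add: gJ)
  qed
  \<comment> \<open>Among the frame vectors only \<open>Z\<^sub>2\<close>, which has index
    \<open>2 * h + 1\<close>, is not annihilated by \<open>a\<^sub>2\<close>.\<close>
  also have "alt_sum (2 * h + 2) ?F v = alt_sum (2 * h + 1) ?F v"
  proof -
    have "?F (\<lambda>i. v (\<sigma> i)) = 0" if "\<sigma> permutes {..<Suc (2 * h + 1)}" "\<sigma> (2 * h + 1) \<noteq> 2 * h + 1" for \<sigma>
      using a2[OF that(2)] permutes_in_image[OF that(1), of "2 * h + 1"] by simp
    from alt_sum_peel[where m = "2 * h + 1" and f = ?F and v = v, OF this] show ?thesis by simp
  qed
  also have "\<dots> = alt_sum (1 + 2 * h) ?G v"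
    unfolding alt_sum_def
  proof (intro sum.cong)
    fix \<sigma> assume "\<sigma> \<in> {\<sigma>. \<sigma> permutes {..<1 + 2 * h}}"
    then have "\<sigma> (2 * h + 1) = 2 * h + 1" by (auto intro: permutes_not_in)
    then have "a\<^sub>2 (v (\<sigma> (2 * h + 1))) = 1" using vZ reeb_a by simp
    then show "of_int (sign \<sigma>) * ?F (\<lambda>i. v (\<sigma> i)) = of_int (sign \<sigma>) * ?G (\<lambda>i. v (\<sigma> i))"
      by (simp only: mult_1_right)
  qed (simp add: add.commute)
  also have "\<dots> = (- 2) ^ h * fact h * alt_sum 1 (\<lambda>w. a\<^sub>1 (w 0)) v"
  proof (rule alt_sum_unitary_pairs[OF _ skew(1) bil_g])
    show "depends_below 1 (\<lambda>w. a\<^sub>1 (w 0))" by (simp add: depends_below_def)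
    show "g (v i) (v j) = (if i = j then 1 else 0)" if "i < 1 + 2 * h" "j < 1 + 2 * h" for i j
      using on that by simp
    fix l assume l: "l < h"
    have x: "v (1 + 2 * l) = Xs ! l" "v (1 + 2 * l + 1) = J (Xs ! l)"
      using vX[of "2 * l"] vX[of "2 * l + 1"] nth_pairs[of l Xs J] l len by (simp_all add: add.assoc)
    then show "J (v (1 + 2 * l)) = v (1 + 2 * l + 1)" by simp
    show "J (v (1 + 2 * l + 1)) = - v (1 + 2 * l)"
      unfolding x(2) unfolding x(1)[symmetric] by (rule JJ_ker) (use a1 a2 l in auto)
  next
    fix i j assume ij: "i < 1 + 2 * h" "j < 1 + 2 * h"
    have 0: "b\<^sub>1 (v 0) u = 0" for u using v0 reeb_b by simp
    have "b\<^sub>2 (v l) u = 0" if "l < 1 + 2 * h" for l u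
      using T2[of l] that by (auto simp: T\<^sub>2_def)
    then show "b\<^sub>1 (v i) (v j) = (if 1 \<le> i \<and> 1 \<le> j then g (v i) (J (v j)) else 0)"
      using 0 skew(1)[of "v i" "v 0"] ij by (cases "i = 0"; cases "j = 0") (simp_all add: gJ)
  qed
  also have "alt_sum 1 (\<lambda>w. a\<^sub>1 (w 0)) v = 1"
    using v0 reeb_a by (simp add: alt_sum_1)
  finally show ?thesis
    unfolding v_def by (simp add: power_add power_minus[of "2::real"] mult_ac)
qed

text \<open>The contact form takes the same value on \<open>F\<close> as on the given
  \<open>E\<close>, since the transition determinant is one. This value is the factor by which it
  differs from the coframe product of \<open>F\<close>.\<close>

lemma volume_form:
  assumes "phi_frame E" "orthonormal_frame g F" "same_orientation E F" "dual_coframe F \<theta>"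
  shows "wedge_coframe \<theta> DIM('e) = (\<lambda>v. (-1) ^ (h + k) / (2 ^ (h + k) * fact h * fact k) *
    wedge (2 * h + 1) (2 * k + 1)
      (wedge 1 (2 * h) (form1 a\<^sub>1) (wedge_power2 (form2 b\<^sub>1) h))
      (wedge 1 (2 * k) (form1 a\<^sub>2) (wedge_power2 (form2 b\<^sub>2) k)) v)"
proof
  fix v
  let ?n = "DIM('e)" and ?T = "contact_tensor h k a\<^sub>1 b\<^sub>1 a\<^sub>2 b\<^sub>2"
  let ?A = "\<lambda>\<theta>. alt_sum ?n (\<lambda>w. \<Prod>i<?n. \<theta> i (w i))"
  let ?C = "2 ^ (h + k) * fact h * fact k :: real"
  have E: "orthonormal_frame g E" using assms(1) by (simp add: phi_frame_def)
  have lin: "linear (\<lambda>x. g x y)" for y using bil_g by (simp add: bilinear_def)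
  have T: "multilinear_form ?n ?T"
    unfolding DIM by (rule multilinear_contact_tensor[OF lin_a bil_b])
  have "alt_sum ?n ?T ((!) F) = alt_sum ?n ?T ((!) E) * ?A (\<lambda>i x. g x (E ! i)) ((!) F)"
    by (rule alt_sum_eq_coframe[OF T])
      (use orthonormal_frame_expand[OF bil_g E] lin E in \<open>auto simp: orthonormal_frame_def\<close>)
  also have "\<dots> = (- 1) ^ (h + k) * ?C"
    using alt_sum_same_orientation[OF bil_g E assms(2,3)] alt_sum_contact_tensor_phi_frame[OF assms(1)]
    by (simp add: DIM)
  finally have TF: "alt_sum ?n ?T ((!) F) = (- 1) ^ (h + k) * ?C" .
  have "alt_sum ?n ?T v = alt_sum ?n ?T ((!) F) * ?A \<theta> v"
  proof (rule alt_sum_eq_coframe[OF T])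
    show "x = (\<Sum>i<?n. \<theta> i x *\<^sub>R F ! i)" for x
      by (rule dual_coframe_expand[OF bil_g assms(2,4)])
  qed (use assms(2,4) in \<open>auto simp: orthonormal_frame_def dual_coframe_def\<close>)
  then have "alt_sum ?n ?T v = (- 1) ^ (h + k) * ?C * ?A \<theta> v"
    unfolding TF .
  moreover have "?C \<noteq> 0" by simp
  moreover have "(- 1) ^ (h + k) * (- 1) ^ (h + k) = (1::real)"
    by (simp flip: power_mult_distrib)
  ultimately have "?A \<theta> v = (- 1) ^ (h + k) / ?C * alt_sum ?n ?T v"
    by (simp add: field_simps)
  then show "wedge_coframe \<theta> ?n v = (- 1) ^ (h + k) / ?C * wedge (2 * h + 1) (2 * k + 1)
      (wedge 1 (2 * h) (form1 a\<^sub>1) (wedge_power2 (form2 b\<^sub>1) h))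
      (wedge 1 (2 * k) (form1 a\<^sub>2) (wedge_power2 (form2 b\<^sub>2) k)) v"
    unfolding wedge_coframe_eq_alt_sum wedge_contact_tensor[of b\<^sub>1 b\<^sub>2, OF skew] DIM[symmetric] by simp
qed

end

section \<open>The volume element\<close>

text \<open>For fields with constant coefficients in the preferred chart,
  \<open>ext_d_fields_eq\<close> expresses the value through the derivatives \<open>D\<close> of the
  components of \<open>\<alpha>\<close>, antisymmetrised; both claims can be read off.\<close>

lemma ext_d_bilinear:
  assumes mfd: "smooth_manifold M A" and \<alpha>: "one_form M A \<alpha>" and p: "p \<in> topspace M"
  shows "bilinear (ext_d A \<alpha> p)" "ext_d A \<alpha> p u v = - ext_d A \<alpha> p v u"
proof -
  define c where "c = chart_at A p"
  define D where "D e = frechet_derivative (\<lambda>y. \<alpha> (chart_inv c y) (tvec A c (chart_inv c y) e)) (at (snd c p))" for e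
  note c = chart_at[OF mfd p, folded c_def]
  have D: "linear (D e)" for e
    unfolding D_def
  proof (rule linear_frechet_derivative, rule smooth_on_differentiable)
    show "smooth_on (snd c ` fst c) (\<lambda>y. \<alpha> (chart_inv c y) (tvec A c (chart_inv c y) e))"
      using \<alpha> c by (auto simp: one_form_def)
  qed (use c in auto)
  have eq: "ext_d A \<alpha> p u v = ((\<Sum>b\<in>Basis. (v \<bullet> b) * D b u) - (\<Sum>b\<in>Basis. (u \<bullet> b) * D b v)) / 2" for u v
    unfolding ext_d_def Let_def
      ext_d_fields_eq[OF mfd \<alpha> p openin_topspace p field_coord_tvec[OF mfd p] field_coord_tvec[OF mfd p]]
    using tvec_chart_at[OF mfd p] by (simp add: D_def c_def)
  show "ext_d A \<alpha> p u v = - ext_d A \<alpha> p v u"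
    unfolding eq by (simp only: minus_divide_left minus_diff_eq)
  show "bilinear (ext_d A \<alpha> p)"
    unfolding bilinear_def linear_iff eq
    by (auto simp: linear_add[OF D] linear_cmul[OF D] inner_add_left algebra_simps sum.distrib sum_distrib_left
        add_divide_distrib diff_divide_distrib)
qed

theorem proposition3p1:
  fixes M :: "'a topology"
    and A :: "('a, 'e::euclidean_space) chart set"
    and h k :: nat
    and \<alpha>\<^sub>1 \<alpha>\<^sub>2 :: "'a \<Rightarrow> 'e \<Rightarrow> real"
    and Z\<^sub>1 Z\<^sub>2 :: "'a \<Rightarrow> 'e"
    and \<phi> :: "'a \<Rightarrow> 'e \<Rightarrow> 'e"
    and g :: "'a \<Rightarrow> 'e \<Rightarrow> 'e \<Rightarrow> real"
  assumes "smooth_manifold M A"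
    and "metric_contact_pair M A h k \<alpha>\<^sub>1 \<alpha>\<^sub>2 Z\<^sub>1 Z\<^sub>2 \<phi> g"
    and "decomposable M A \<alpha>\<^sub>1 \<alpha>\<^sub>2 \<phi>"
  shows "\<forall>p\<in>topspace M.
    volume_element (phi_orientation A h k \<alpha>\<^sub>1 \<alpha>\<^sub>2 Z\<^sub>1 Z\<^sub>2 \<phi> g) g p =
      (\<lambda>v. (-1) ^ (h + k) / (2 ^ (h + k) * fact h * fact k) *
            contact_pair_form A h k \<alpha>\<^sub>1 \<alpha>\<^sub>2 p v)"
proof
  fix p assume p: "p \<in> topspace M"
  note d = assms(2)[unfolded metric_contact_pair_def contact_pair_structure_def]
  have cp: "contact_pair M A h k \<alpha>\<^sub>1 \<alpha>\<^sub>2" and rf: "reeb_fields M A \<alpha>\<^sub>1 \<alpha>\<^sub>2 Z\<^sub>1 Z\<^sub>2"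
    and rm: "riemannian_metric M A g" using d by auto
  have one: "one_form M A \<alpha>\<^sub>1" "one_form M A \<alpha>\<^sub>2" using cp by (auto simp: contact_pair_def)
  \<comment> \<open>The claim is pointwise, so only the tangent space at \<open>p\<close> matters
    from here on.\<close>
  interpret metric_contact_space h k "\<alpha>\<^sub>1 p" "\<alpha>\<^sub>2 p" "ext_d A \<alpha>\<^sub>1 p" "ext_d A \<alpha>\<^sub>2 p" "Z\<^sub>1 p" "Z\<^sub>2 p" "\<phi> p" "g p"
  proof (rule metric_contact_space.intro)
    show "linear (\<alpha>\<^sub>1 p)" "linear (\<alpha>\<^sub>2 p)" using one p by (auto simp: one_form_def)
    show "bilinear (ext_d A \<alpha>\<^sub>1 p)" "bilinear (ext_d A \<alpha>\<^sub>2 p)"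
      by (rule ext_d_bilinear[OF assms(1) _ p] one)+
    show "ext_d A \<alpha>\<^sub>1 p u v = - ext_d A \<alpha>\<^sub>1 p v u" "ext_d A \<alpha>\<^sub>2 p u v = - ext_d A \<alpha>\<^sub>2 p v u" for u v
      by (rule ext_d_bilinear[OF assms(1) _ p] one)+
    show "g p u v = g p v u" for u v using rm p unfolding riemannian_metric_def by blast
    show "\<phi> p ` ({u. \<alpha>\<^sub>1 p u = 0} \<inter> {u. \<forall>v. ext_d A \<alpha>\<^sub>1 p u v = 0}) \<subseteq>
        {u. \<alpha>\<^sub>1 p u = 0} \<inter> {u. \<forall>v. ext_d A \<alpha>\<^sub>1 p u v = 0}"
      "\<phi> p ` ({u. \<alpha>\<^sub>2 p u = 0} \<inter> {u. \<forall>v. ext_d A \<alpha>\<^sub>2 p u v = 0}) \<subseteq>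
        {u. \<alpha>\<^sub>2 p u = 0} \<inter> {u. \<forall>v. ext_d A \<alpha>\<^sub>2 p u v = 0}"
      using assms(3) p unfolding decomposable_def char_distribution_def by blast+
  qed (use cp rf rm d p in \<open>auto simp: contact_pair_def reeb_fields_def riemannian_metric_def\<close>)
  have phi_basis: "phi_basis A h k \<alpha>\<^sub>1 \<alpha>\<^sub>2 Z\<^sub>1 Z\<^sub>2 \<phi> g p E \<longleftrightarrow> phi_frame E" for E
    unfolding phi_basis_def phi_frame_def T\<^sub>1_def T\<^sub>2_def char_distribution_def ..
  let ?dV = "\<lambda>v. (-1) ^ (h + k) / (2 ^ (h + k) * fact h * fact k) * contact_pair_form A h k \<alpha>\<^sub>1 \<alpha>\<^sub>2 p v"
  have vol: "wedge_coframe \<theta> DIM('e) = ?dV"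
    if "phi_frame E" "orthonormal_frame (g p) F" "same_orientation E F" "dual_coframe F \<theta>" for E F \<theta>
    unfolding contact_pair_form_def by (rule volume_form[OF that])
  obtain E where E: "phi_frame E" using phi_frame_exists by blast
  then have onE: "orthonormal_frame (g p) E" by (simp add: phi_frame_def)
  have dE: "dual_coframe E (\<lambda>i x. g p x (E ! i))"
    using onE bil_g by (auto simp: dual_coframe_def orthonormal_frame_def bilinear_def)
  show "volume_element (phi_orientation A h k \<alpha>\<^sub>1 \<alpha>\<^sub>2 Z\<^sub>1 Z\<^sub>2 \<phi> g) g p = ?dV"
    unfolding volume_element_def phi_orientation_def phi_basis
  \<comment> \<open>\<open>vol\<close> covers every positive orthonormal frame and every dual
    coframe, so \<open>?dV\<close> meets the description. Uniqueness requires that at least one such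
    frame exists, and \<open>E\<close> with the coframe from \<open>dE\<close> is one.\<close>
  proof (rule the_equality)
    show "\<forall>F \<theta>. orthonormal_frame (g p) F \<and> F \<in> {F. \<exists>E. phi_frame E \<and> same_orientation E F} \<and>
        dual_coframe F \<theta> \<longrightarrow> ?dV = wedge_coframe \<theta> DIM('e)"
    proof (intro allI impI, elim conjE CollectE exE)
      fix F \<theta> E' assume "orthonormal_frame (g p) F" "dual_coframe F \<theta>" "phi_frame E'" "same_orientation E' F"
      then show "?dV = wedge_coframe \<theta> DIM('e)" using vol[of E' F \<theta>] by simp
    qed
    fix \<omega> assume \<omega>: "\<forall>F \<theta>. orthonormal_frame (g p) F \<and> F \<in> {F. \<exists>E. phi_frame E \<and> same_orientation E F} \<and>
        dual_coframe F \<theta> \<longrightarrow> \<omega> = wedge_coframe \<theta> DIM('e)"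
    have "E \<in> {F. \<exists>E. phi_frame E \<and> same_orientation E F}"
      using E same_orientation_refl by blast
    with onE dE have "\<omega> = wedge_coframe (\<lambda>i x. g p x (E ! i)) DIM('e)"
      using \<omega> by blast
    then show "\<omega> = ?dV"
      unfolding vol[OF E onE same_orientation_refl dE] .
  qed
qed

end
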